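(* Let $q\in[1/2,1)$ and $\lambda>0$, and let $T\in\mathcal{L}^{|}$ be a random tree distributed as the exponential invariant Galton-Watson tree $\mathcal{IGW}(q,\lambda)$. Then the length of $T$ has the probability density function $$\ell(x)=\sum_{n=1}^{\infty}(-1)^{n-1}\frac{\Gamma(n/q+1)}{n!\,(n-1)!\,\Gamma(n/q-n+2)}(\lambda q)^n x^{n-1},\qquad x\ge 0,$$ and the cumulative distribution function $$L(x)=\mathsf{P}\big(\mathrm{length}(T)\le x\big)=\sum_{n=1}^{\infty}(-1)^{n-1}\frac{\Gamma(n/q+1)}{n!\,n!\,\Gamma(n/q-n+2)}(\lambda q)^n x^{n},\qquad x\ge 0.$$
   Context: A rooted tree is reduced if it has no vertices of degree 2 except possibly the root, and planted if its root has degree one; the only edge at the root is then called the stem. $\mathcal{T}^{|}$ is the space of finite unlabeled rooted reduced planted trees without planar embedding, together with the empty tree $\phi$ (a root and no edges); $\mathcal{L}^{|}$ is the space of such trees equipped with positive edge lengths (metric trees). $\mathrm{shape}(T)$ is the combinatorial tree underlying a metric tree $T$. For a probability mass function $\{q_k\}_{k\ge0}$ with $q_1=0$ and $\sum_k kq_k\le 1$, $\mathcal{GW}(\{q_k\})$ is the probability measure on $\mathcal{T}^{|}$ induced by the Galton-Watson process that begins with a progenitor (the root) having exactly one offspring, after which every individual independently has $k$ offspring with probability $q_k$. For $q\in[1/2,1)$, $\mathcal{IGW}(q)$ is $\mathcal{GW}(\{q_k\})$ with progeny generating function $Q(z)=\sum_k q_kz^k=z+q(1-z)^{1/q}$. A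 random tree $T$ in $\mathcal{L}^{|}$ has distribution $\mathcal{IGW}(q,\lambda)$ if $\mathrm{shape}(T)$ has distribution $\mathcal{IGW}(q)$ and, conditioned on $\mathrm{shape}(T)$, the edge lengths (including the stem) are i.i.d. exponential with parameter $\lambda$. $\mathrm{length}(T)$ is the sum of the lengths of all edges of $T$. *)

theory Defs
  imports "HOL-Probability.Probability"
begin

text \<open>Finite unlabelled rooted trees without planar embedding: a vertex is the multiset of the
  edges to its children, each edge carrying a label of type \<^typ>\<open>'a\<close>. Combinatorial
  trees have labels in \<^typ>\<open>unit\<close>, metric trees have the edge lengths as labels.\<close>

datatype 'a rtree = Node "('a \<times> 'a rtree) multiset"

primrec edges :: "'a rtree \<Rightarrow> 'a multiset" where
  "edges (Node E) = (\<Sum>x\<in>#image_mset (map_prod id edges) E. {#fst x#} + snd x)"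

definition tree_length :: "real rtree \<Rightarrow> real" where
  "tree_length T = (\<Sum>l\<in>#edges T. l)"

definition shape :: "'a rtree \<Rightarrow> unit rtree" where
  "shape = map_rtree (\<lambda>_. ())"

text \<open>A non-root vertex has degree 2 iff it has exactly one child.\<close>

inductive no_unary :: "'a rtree \<Rightarrow> bool" where
  "size E \<noteq> 1 \<Longrightarrow> (\<And>l t. (l, t) \<in># E \<Longrightarrow> no_unary t) \<Longrightarrow> no_unary (Node E)"

definition planted_trees :: "'a rtree set" where
  "planted_trees = insert (Node {#}) {Node {#(l, t)#} | l t. no_unary t}"

definition metric_trees :: "real rtree set" where
  "metric_trees = {T \<in> planted_trees. \<forall>l\<in>set_rtree T. 0 < l}"

text \<open>A tree \<^term>\<open>e :: nat rtree\<close> with pairwise distinct edge labels names the edges of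
  its shape; a length assignment \<^term>\<open>x :: nat \<Rightarrow> real\<close> then gives the tree
  \<^term>\<open>map_rtree x e\<close> of the same shape. The space of metric trees carries the largest
  \<open>\<sigma>\<close>-algebra making all these charts measurable.\<close>

definition distinct_edges :: "'a rtree \<Rightarrow> bool" where
  "distinct_edges e \<longleftrightarrow> (\<forall>i. count (edges e) i \<le> 1)"

definition metric_tree_space :: "real rtree measure" where
  "metric_tree_space = sigma metric_trees
     {A. A \<subseteq> metric_trees \<and>
         (\<forall>e :: nat rtree. distinct_edges e \<longrightarrow>
            {x \<in> space (\<Pi>\<^sub>M i\<in>set_rtree e. borel). map_rtree x e \<in> A}
              \<in> sets (\<Pi>\<^sub>M i\<in>set_rtree e. borel))}"

text \<open>Galton-Watson process. Individuals are Ulam-Harris words: the progenitor is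
  \<^term>\<open>[] :: nat list\<close>, and the children of \<open>u\<close> are \<open>u @ [i]\<close> for
  \<open>i < \<omega> u\<close>, where \<open>\<omega> u\<close> is the number of offspring of \<open>u\<close>.\<close>

definition gw_process :: "nat pmf \<Rightarrow> (nat list \<Rightarrow> nat) measure" where
  "gw_process p = (\<Pi>\<^sub>M u\<in>UNIV. measure_pmf (if u = [] then return_pmf 1 else p))"

text \<open>\<open>family_tree \<omega> u t\<close>: the individual \<open>u\<close> has finitely many descendants and
  they form the tree \<open>t\<close>.\<close>

inductive family_tree :: "(nat list \<Rightarrow> nat) \<Rightarrow> nat list \<Rightarrow> unit rtree \<Rightarrow> bool"
  for \<omega> :: "nat list \<Rightarrow> nat" where
  "(\<And>i. i < \<omega> u \<Longrightarrow> family_tree \<omega> (u @ [i]) (f i)) \<Longrightarrow>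
     family_tree \<omega> u (Node (image_mset (\<lambda>i. ((), f i)) (mset_set {..<\<omega> u})))"

definition GW :: "nat pmf \<Rightarrow> unit rtree measure" where
  "GW p = density (count_space planted_trees)
     (\<lambda>\<tau>. emeasure (gw_process p) {\<omega> \<in> space (gw_process p). family_tree \<omega> [] \<tau>})"

definition has_pgf :: "nat pmf \<Rightarrow> (real \<Rightarrow> real) \<Rightarrow> bool" where
  "has_pgf p Q \<longleftrightarrow> (\<forall>z\<in>{0..1}. (\<lambda>k. pmf p k * z ^ k) sums Q z)"

definition IGW :: "real \<Rightarrow> unit rtree measure \<Rightarrow> bool" where
  "IGW q D \<longleftrightarrow> (\<exists>p. has_pgf p (\<lambda>z. z + q * (1 - z) powr (1 / q)) \<and> D = GW p)"

definition iid_exponential :: "real \<Rightarrow> nat set \<Rightarrow> (nat \<Rightarrow> real) measure" where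
  "iid_exponential lam I = (\<Pi>\<^sub>M i\<in>I. density lborel (exponential_density lam))"

text \<open>The last conjunct of the next definition: given the shape, \<open>T\<close> is distributed as
  \<^term>\<open>map_rtree x e\<close> with i.i.d. exponential \<^term>\<open>x\<close>, for any naming
  \<^term>\<open>e\<close> of the edges of that shape. The law does not depend on the naming.\<close>

definition exponential_IGW ::
    "real \<Rightarrow> real \<Rightarrow> 'w measure \<Rightarrow> ('w \<Rightarrow> real rtree) \<Rightarrow> bool" where
  "exponential_IGW q lam M T \<longleftrightarrow>
     T \<in> measurable M metric_tree_space \<and>
     IGW q (distr M (count_space planted_trees) (\<lambda>\<omega>. shape (T \<omega>))) \<and>
     (\<forall>e \<in> planted_trees. \<forall>A \<in> sets metric_tree_space.
        distinct_edges e \<and> \<P>(\<omega> in M. shape (T \<omega>) = shape e) > 0 \<longrightarrow>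
        \<P>(\<omega> in M. T \<omega> \<in> A \<bar> shape (T \<omega>) = shape e) =
        \<P>(x in iid_exponential lam (set_rtree e). map_rtree x e \<in> A))"

text \<open>The \<open>n\<close>-th terms, \<open>n \<ge> 1\<close>, of the two series.\<close>

definition pdf_term :: "real \<Rightarrow> real \<Rightarrow> real \<Rightarrow> nat \<Rightarrow> real" where
  "pdf_term q lam x n =
     (-1) ^ (n - 1) * (Gamma (real n / q + 1) /
       (fact n * fact (n - 1) * Gamma (real n / q - real n + 2))) * (lam * q) ^ n * x ^ (n - 1)"

definition cdf_term :: "real \<Rightarrow> real \<Rightarrow> real \<Rightarrow> nat \<Rightarrow> real" where
  "cdf_term q lam x n =
     (-1) ^ (n - 1) * (Gamma (real n / q + 1) /
       (fact n * fact n * Gamma (real n / q - real n + 2))) * (lam * q) ^ n * x ^ n"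

end

theory Submission
  imports Defs "HOL-Complex_Analysis.Cauchy_Integral_Formula"
begin

text \<open>Given its shape, the length of the tree is a sum of i.i.d. exponential variables, one per edge.
  Hence the density is the mixture of the Erlang densities with weights \<open>p\<^sub>m\<close>, the probability of
  exactly \<open>m\<close> edges:
  \<open>\<ell>(x) = \<lambda> exp(-\<lambda>x) \<Sum>\<^sub>m p\<^sub>m (\<lambda>x)\<^sup>m\<^sup>-\<^sup>1 / (m-1)!\<close>. Multiplying out the exponential series turns
  this into a power series whose coefficients are the alternating binomial transform of \<open>p\<close>. On
  generating functions that transform is the substitution \<open>D(w) = P(w / (1 + w))\<close>; it takes
  \<open>P = z Q(P)\<close>, with \<open>Q(z) = z + q (1 - z)\<^bsup>1/q\<^esup>\<close>, to \<open>D = q w (1 - D)\<^bsup>1/q\<^esup>\<close>, so Lagrange inversion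
  gives the coefficients. The distribution function is obtained by termwise integration.\<close>

subsection \<open>Lagrange inversion\<close>

lemma fps_nth_power_eq_0:
  fixes g :: "'a::comm_ring_1 fps"
  assumes "fps_nth g 0 = 0" "m < k"
  shows "fps_nth (g ^ k) m = 0"
  using assms startsby_zero_power_prefix by blast

text \<open>Since \<open>g\<close> has no constant term, \<open>g ^ k\<close> starts at order
  \<open>k\<close>. Every inner sum can therefore run to the common bound \<open>N\<close>, and the
  two sums can be exchanged.\<close>

lemma fps_nth_mult_compose:
  fixes g :: "'a::comm_ring_1 fps"
  assumes "fps_nth g 0 = 0"
  shows "fps_nth (h * (a oo g)) N = (\<Sum>k\<le>N. fps_nth a k * fps_nth (h * g ^ k) N)"
proof -
  have "fps_nth (h * (a oo g)) N
      = (\<Sum>i=0..N. \<Sum>k\<le>N. fps_nth a k * (fps_nth h i * fps_nth (g ^ k) (N - i)))"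
    unfolding fps_mult_nth
  proof (rule sum.cong[OF refl])
    fix i assume "i \<in> {0..N}"
    have "fps_nth (a oo g) (N - i) = (\<Sum>k\<in>{0..N - i}. fps_nth a k * fps_nth (g ^ k) (N - i))"
      by (simp add: fps_compose_nth)
    also have "\<dots> = (\<Sum>k\<le>N. fps_nth a k * fps_nth (g ^ k) (N - i))"
      using assms by (intro sum.mono_neutral_left) (auto simp: fps_nth_power_eq_0)
    finally show "fps_nth h i * fps_nth (a oo g) (N - i)
        = (\<Sum>k\<le>N. fps_nth a k * (fps_nth h i * fps_nth (g ^ k) (N - i)))"
      by (simp add: sum_distrib_left mult_ac)
  qed
  also have "\<dots> = (\<Sum>k\<le>N. fps_nth a k * fps_nth (h * g ^ k) N)"
    by (subst sum.swap) (simp add: fps_mult_nth sum_distrib_left)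
  finally show ?thesis .
qed

text \<open>With \<open>g = X / \<phi>\<close> the compositional inverse of \<open>D\<close>, compare the residues of both sides of
  \<open>\<phi>\<^sup>n / X\<^sup>n = \<phi>\<^sup>n / X\<^sup>n * (D \<circ> g)'\<close>: on the right only the term \<open>n * D\<^sub>n\<close> survives, since
  \<open>g\<^sup>k\<^sup>-\<^sup>n * g'\<close> is a derivative for all other exponents. Multiplying by \<open>X\<^sup>n\<close> keeps everything
  within power series.\<close>

theorem fps_lagrange_inversion:
  fixes D \<phi> :: "'a::field_char_0 fps"
  assumes D: "D = fps_X * (\<phi> oo D)" and \<phi>: "fps_nth \<phi> 0 \<noteq> 0" and n: "n \<ge> 1"
  shows "of_nat n * fps_nth D n = fps_nth (\<phi> ^ n) (n - 1)"
proof -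
  define g where "g = fps_X * inverse \<phi>"
  have D0: "fps_nth D 0 = 0" by (subst D) simp
  have D1: "fps_nth D 1 \<noteq> 0" by (subst D) (simp add: \<phi>)
  have g0: "fps_nth g 0 = 0" by (simp add: g_def)
  have inv1: "\<phi> * inverse \<phi> = 1" using \<phi> by (simp add: inverse_mult_eq_1')
  have "g oo D = D * inverse (\<phi> oo D)"
    using D0 \<phi> by (simp add: g_def fps_compose_mult_distrib fps_inverse_compose)
  also have "\<dots> = fps_X * ((\<phi> oo D) * inverse (\<phi> oo D))"
    by (subst (1) D) (simp add: mult_ac)
  also have "\<dots> = fps_X" using \<phi> by (simp add: inverse_mult_eq_1')
  finally have gD: "g oo D = fps_X" .
  \<comment> \<open>Composing \<open>g oo D = fps_X\<close> with \<open>fps_inv D\<close> identifies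
    \<open>g\<close> as \<open>fps_inv D\<close>, which gives the composition in the other order as
    well.\<close>
  have "g = g oo (D oo fps_inv D)"
    by (simp add: fps_inv_right[OF D0 D1])
  also have "\<dots> = fps_inv D"
    using D0 by (simp add: fps_compose_assoc gD fps_inv_def)
  finally have Dg: "D oo g = fps_X" by (simp add: fps_inv_right[OF D0 D1])
  have one: "(fps_deriv D oo g) * fps_deriv g = 1"
    using fps_compose_deriv[OF g0, of D] Dg by simp
  have deriv_g: "\<phi> * fps_deriv g = 1 - fps_X * fps_deriv \<phi> * inverse \<phi>"
  proof -
    have "fps_deriv (\<phi> * inverse \<phi>) = 0" by (simp add: inv1)
    hence *: "\<phi> * fps_deriv (inverse \<phi>) = - (fps_deriv \<phi> * inverse \<phi>)"
      by (simp add: add_eq_0_iff mult.commute)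
    have "\<phi> * fps_deriv g = \<phi> * inverse \<phi> + fps_X * (\<phi> * fps_deriv (inverse \<phi>))"
      by (simp add: g_def algebra_simps)
    thus ?thesis by (simp add: * inv1 mult_ac)
  qed
  have residue: "fps_nth (\<phi> ^ n * fps_deriv g * g ^ k) (n - 1) = (if k = n - 1 then 1 else 0)"
    if k: "k \<le> n - 1" for k
  proof -
    \<comment> \<open>\<open>j\<close> is the power of \<open>\<phi>\<close> left over:
      \<open>g ^ k\<close> absorbs \<open>k\<close> of the \<open>n\<close> factors, and one more is
      paired with \<open>fps_deriv g\<close>.\<close>
    define j where "j = n - 1 - k"
    have nj: "n = Suc j + k" using n k by (simp add: j_def)
    have "\<phi> ^ n * fps_deriv g * g ^ k
        = fps_X ^ k * (\<phi> ^ j * (\<phi> * fps_deriv g)) * (\<phi> * inverse \<phi>) ^ k"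
      by (simp add: nj g_def power_add power_mult_distrib mult_ac)
    also have "\<dots> = fps_X ^ k * (\<phi> ^ j * (1 - fps_X * fps_deriv \<phi> * inverse \<phi>))"
      by (simp add: inv1 deriv_g)
    finally have "fps_nth (\<phi> ^ n * fps_deriv g * g ^ k) (n - 1)
        = fps_nth (\<phi> ^ j * (1 - fps_X * fps_deriv \<phi> * inverse \<phi>)) j"
      using k by (simp only: mult.assoc fps_X_power_mult_nth) (simp add: j_def)
    also have "\<dots> = (if j = 0 then 1 else 0)"
    proof (cases j)
      case 0
      thus ?thesis by simp
    next
      case (Suc i)
      have "\<phi> ^ j * (1 - fps_X * fps_deriv \<phi> * inverse \<phi>)
          = \<phi> ^ j - fps_X * (\<phi> ^ i * fps_deriv \<phi>) * (\<phi> * inverse \<phi>)"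
        by (simp add: Suc algebra_simps)
      \<comment> \<open>For \<open>j > 0\<close> the two coefficients cancel: the one of
        \<open>\<phi> ^ j\<close> at \<open>j\<close> is recovered from its derivative, and the
        factor \<open>of_nat j\<close> divides out.\<close>
      moreover have "fps_deriv (\<phi> ^ j) = of_nat j * (\<phi> ^ i * fps_deriv \<phi>)"
        by (simp only: fps_deriv_power' Suc diff_Suc_1 mult_ac)
      hence "of_nat j * fps_nth (\<phi> ^ j) j = of_nat j * fps_nth (\<phi> ^ i * fps_deriv \<phi>) i"
        using fps_deriv_nth[of "\<phi> ^ j" i]
        by (simp add: Suc fps_of_nat[symmetric] del: of_nat_Suc)
      hence "fps_nth (\<phi> ^ j) j = fps_nth (\<phi> ^ i * fps_deriv \<phi>) i"
        by (simp add: Suc del: of_nat_Suc)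
      ultimately show ?thesis by (simp add: inv1 Suc)
    qed
    finally show ?thesis using n k by (auto simp: j_def)
  qed
  have "fps_nth (\<phi> ^ n) (n - 1) = fps_nth (\<phi> ^ n * fps_deriv g * (fps_deriv D oo g)) (n - 1)"
    using one by (simp add: mult.assoc mult.commute[of "fps_deriv g"])
  also have "\<dots> = (\<Sum>k\<le>n - 1. fps_nth (fps_deriv D) k * (if k = n - 1 then 1 else 0))"
    unfolding fps_nth_mult_compose[OF g0]
    by (intro sum.cong refl arg_cong2[where f = "(*)"] residue) simp
  also have "\<dots> = of_nat n * fps_nth D n"
    using n by (simp add: sum.If_cases if_distrib[of "\<lambda>x. _ * x"] cong: if_cong)
  finally show ?thesis ..
qed

text \<open>The denominator is a negative binomial series. Because \<open>n \<ge> 1\<close>, the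
  power \<open>m = 0\<close> contributes nothing.\<close>

lemma fps_nth_power_X_over_1_plus_X:
  assumes "n \<ge> 1"
  shows "fps_nth ((fps_X * inverse (1 + fps_X)) ^ m :: real fps) n
    = (if 1 \<le> m \<and> m \<le> n then (-1) ^ (n - m) * real ((n - 1) choose (n - m)) else 0)"
proof -
  have "(fps_X * inverse (1 + fps_X)) ^ m = (fps_X ^ m * fps_binomial (- real m) :: real fps)"
    by (simp add: power_mult_distrib fps_binomial_minus_of_nat fps_inverse_power)
  moreover have "(- real m) gchoose (n - m) = (-1) ^ (n - m) * real ((n - 1) choose (n - m))"
    if "1 \<le> m" "m \<le> n"
  proof -
    have "real m + real (n - m) - 1 = real (n - 1)" using that by (simp add: of_nat_diff)
    thus ?thesis by (simp add: gbinomial_minus binomial_gbinomial)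
  qed
  ultimately show ?thesis using assms by (cases "m = 0") (auto simp: fps_X_power_mult_nth)
qed

text \<open>The substitution \<open>D = P \<circ> (X / (1 + X))\<close> absorbs the linear term of the generating function,
  leaving \<open>D = q X (1 - D)\<^sup>a\<close>, to which Lagrange inversion applies.\<close>

lemma total_progeny_coefficients:
  fixes P :: "real fps" and a q :: real
  assumes P: "P = fps_X * ((fps_X + fps_const q * (fps_binomial a oo - fps_X)) oo P)"
    and q: "q \<noteq> 0" and n: "n \<ge> 1"
  shows "(\<Sum>m=1..n. (-1) ^ (n - m) * real ((n - 1) choose (n - m)) * fps_nth P m)
    = (-1) ^ (n - 1) * q ^ n / real n * ((real n * a) gchoose (n - 1))"
proof -
  define V where "V = fps_X * inverse (1 + fps_X :: real fps)"
  define B where "B = fps_binomial a oo (- fps_X :: real fps)"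
  define D where "D = P oo V"
  have V0: "fps_nth V 0 = 0" by (simp add: V_def)
  have P0: "fps_nth P 0 = 0" by (subst P) simp
  have V: "(1 + fps_X) * V = fps_X"
    by (simp add: V_def inverse_mult_eq_1' mult.left_commute)
  have "P = fps_X * (P + fps_const q * (B oo P))"
    by (subst (1) P) (simp add: B_def fps_compose_add_distrib fps_compose_mult_distrib P0)
  hence "D = V * (D + fps_const q * (B oo P oo V))"
    unfolding D_def
    by (metis (no_types, lifting) V0 fps_compose_add_distrib fps_compose_mult_distrib
          fps_X_fps_compose_startby0 fps_const_compose)
  also have "B oo P oo V = B oo D"
    unfolding D_def by (rule fps_compose_assoc[symmetric, OF V0 P0])
  \<comment> \<open>Multiplying by \<open>1 + fps_X\<close> clears the denominator of
    \<open>V\<close>. The linear term of the offspring series then puts \<open>fps_X * D\<close> on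
    both sides, where it cancels.\<close>
  finally have "(1 + fps_X) * D = ((1 + fps_X) * V) * (D + fps_const q * (B oo D))"
    by (simp add: mult.assoc)
  hence "D = fps_X * (fps_const q * (B oo D))"
    unfolding V by (simp add: algebra_simps)
  also have "fps_const q * (B oo D) = (fps_const q * B) oo D"
    by (simp add: fps_compose_mult_distrib D_def P0)
  finally have D: "D = fps_X * ((fps_const q * B) oo D)" .
  have "of_nat n * fps_nth D n = fps_nth ((fps_const q * B) ^ n) (n - 1)"
    by (rule fps_lagrange_inversion[OF D _ n]) (simp add: q B_def)
  also have "(fps_const q * B) ^ n = fps_const (q ^ n) * (fps_binomial (real n * a) oo - fps_X)"
    by (simp add: B_def power_mult_distrib fps_compose_power fps_binomial_power)
  also have "fps_nth \<dots> (n - 1) = q ^ n * ((-1) ^ (n - 1) * ((real n * a) gchoose (n - 1)))"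
    by (simp add: fps_compose_uminus')
  finally have "fps_nth D n = (-1) ^ (n - 1) * q ^ n / real n * ((real n * a) gchoose (n - 1))"
    using n by (simp add: field_simps)
  moreover have "fps_nth D n = (\<Sum>m=0..n. fps_nth P m * fps_nth (V ^ m) n)"
    by (simp add: D_def fps_compose_nth)
  moreover have "\<dots> = (\<Sum>m=1..n. fps_nth P m * fps_nth (V ^ m) n)"
    by (intro sum.mono_neutral_right) (auto simp: P0 not_le Suc_le_eq)
  moreover have "\<dots> = (\<Sum>m=1..n. (-1) ^ (n - m) * real ((n - 1) choose (n - m)) * fps_nth P m)"
    unfolding V_def by (intro sum.cong refl) (simp add: fps_nth_power_X_over_1_plus_X[OF n])
  ultimately show ?thesis by simp
qed

subsection \<open>Total progeny of planar trees\<close>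

text \<open>Genealogies are first counted with their birth order, as planar trees: these correspond
  to elementary cylinder events of the process.\<close>

datatype ptree = PN (children: "ptree list")

primrec nodes :: "ptree \<Rightarrow> nat" where
  "nodes (PN ts) = Suc (sum_list (map nodes ts))"

primrec weight :: "(nat \<Rightarrow> real) \<Rightarrow> ptree \<Rightarrow> real" where
  "weight q (PN ts) = q (length ts) * prod_list (map (weight q) ts)"

abbreviation forest_nodes :: "ptree list \<Rightarrow> nat" where
  "forest_nodes ts \<equiv> sum_list (map nodes ts)"

text \<open>For an offspring law \<open>q\<close> this is the generating function of the total
  progeny. By \<open>finite_nodes_eq\<close> the sums range over finite sets, so none of them takes
  the default value 0 of an infinite sum.\<close>

definition progeny_fps :: "(nat \<Rightarrow> real) \<Rightarrow> real fps" where
  "progeny_fps q = Abs_fps (\<lambda>n. \<Sum>t | nodes t = n. weight q t)"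

lemma nodes_pos [simp]: "0 < nodes t"
  by (cases t) simp

lemma length_le_forest_nodes: "length ts \<le> forest_nodes ts"
proof (induction ts)
  case (Cons t ts)
  thus ?case using nodes_pos[of t] by (simp del: nodes_pos)
qed simp

lemma nodes_le_forest_nodes: "t \<in> set ts \<Longrightarrow> nodes t \<le> forest_nodes ts"
  by (induction ts) auto

text \<open>A tree with at most \<open>n + 1\<close> nodes has at most \<open>n\<close> children
  with at most \<open>n\<close> nodes each, so it comes from a finite set of lists.\<close>

lemma finite_nodes_le: "finite {t. nodes t \<le> n}"
proof (induction n)
  case 0
  have empty: "{t. nodes t \<le> 0} = {}" using nodes_pos by (metis (mono_tags) empty_Collect_eq not_le)
  show ?case unfolding empty by simp
next
  case (Suc n)
  have "{t. nodes t \<le> Suc n} \<subseteq> PN ` {ts. set ts \<subseteq> {t. nodes t \<le> n} \<and> length ts \<le> n}"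
  proof
    fix t assume t: "t \<in> {t. nodes t \<le> Suc n}"
    obtain ts where ts: "t = PN ts" by (cases t)
    thus "t \<in> PN ` {ts. set ts \<subseteq> {t. nodes t \<le> n} \<and> length ts \<le> n}"
      using t nodes_le_forest_nodes[of _ ts] length_le_forest_nodes[of ts]
      by (force intro: order_trans)
  qed
  thus ?case
    using finite_lists_length_le[OF Suc] finite_subset by blast
qed

lemma finite_nodes_eq: "finite {t. nodes t = n}"
  by (rule finite_subset[OF _ finite_nodes_le[of n]]) auto

lemma finite_forest_nodes_eq: "finite {ts. forest_nodes ts = m}"
proof (rule finite_subset)
  show "{ts. forest_nodes ts = m} \<subseteq> children ` {t. nodes t \<le> Suc m}"
  proof
    fix ts assume "ts \<in> {ts. forest_nodes ts = m}"
    hence "PN ts \<in> {t. nodes t \<le> Suc m}" by simp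
    thus "ts \<in> children ` {t. nodes t \<le> Suc m}" by (metis imageI ptree.sel)
  qed
qed (use finite_nodes_le in simp)

text \<open>Powers count ordered forests: the Cauchy product splits off the first tree, the
  summation index being its number of nodes.\<close>

lemma progeny_fps_power_nth:
  "fps_nth (progeny_fps q ^ k) m
    = (\<Sum>ts | length ts = k \<and> forest_nodes ts = m. prod_list (map (weight q) ts))"
proof (induction k arbitrary: m)
  case 0
  have "{ts. length ts = 0 \<and> forest_nodes ts = m} = (if m = 0 then {[]} else {})" by auto
  thus ?case by simp
next
  case (Suc k)
  define F where "F j = {ts. length ts = k \<and> forest_nodes ts = j}" for j
  have fin: "finite (F j)" for j
    unfolding F_def by (rule finite_subset[OF _ finite_forest_nodes_eq[of j]]) auto
  have "fps_nth (progeny_fps q ^ Suc k) m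
      = (\<Sum>i\<in>{..m}. \<Sum>t\<in>{t\<in>{t. nodes t \<le> m}. nodes t = i}.
          weight q t * (\<Sum>ts\<in>F (m - nodes t). prod_list (map (weight q) ts)))"
    unfolding power_Suc fps_mult_nth Suc.IH atLeast0AtMost
    by (intro sum.cong refl)
       (auto simp: progeny_fps_def F_def sum_distrib_right intro!: sum.cong)
  also have "\<dots> = (\<Sum>t | nodes t \<le> m.
          weight q t * (\<Sum>ts\<in>F (m - nodes t). prod_list (map (weight q) ts)))"
    by (rule sum.group) (auto simp: finite_nodes_le)
  also have "\<dots> = (\<Sum>(t, ts)\<in>(SIGMA t:{t. nodes t \<le> m}. F (m - nodes t)).
          prod_list (map (weight q) (t # ts)))"
    by (simp add: sum_distrib_left sum.Sigma finite_nodes_le fin)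
  also have "\<dots> = (\<Sum>ts | length ts = Suc k \<and> forest_nodes ts = m. prod_list (map (weight q) ts))"
    by (rule sum.reindex_bij_witness[of _ "\<lambda>ts. (hd ts, tl ts)" "\<lambda>(t, ts). t # ts"])
       (auto simp: F_def length_Suc_conv)
  finally show ?case .
qed

text \<open>Decomposition at the root: \<open>fps_X\<close> accounts for the root, and its
  \<open>k\<close> children form a forest counted by the \<open>k\<close>-th power with weight
  \<open>q k\<close>. A forest has at least as many nodes as trees, which bounds
  \<open>k\<close>.\<close>

theorem progeny_fps_eq: "progeny_fps q = fps_X * (Abs_fps q oo progeny_fps q)"
proof (rule fps_ext)
  fix n
  show "fps_nth (progeny_fps q) n = fps_nth (fps_X * (Abs_fps q oo progeny_fps q)) n"
  proof (cases n)
    case 0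
    have empty: "{t. nodes t = 0} = {}" using nodes_pos by (metis (mono_tags) empty_Collect_eq less_irrefl)
    show ?thesis unfolding 0 progeny_fps_def fps_nth_Abs_fps empty by simp
  next
    case (Suc m)
    have PN: "nodes t = Suc (forest_nodes (children t))"
      "weight q t = q (length (children t)) * prod_list (map (weight q) (children t))" for t
      by (cases t; simp)+
    have "fps_nth (progeny_fps q) n
        = (\<Sum>ts | forest_nodes ts = m. q (length ts) * prod_list (map (weight q) ts))"
      unfolding progeny_fps_def fps_nth_Abs_fps
      by (rule sum.reindex_bij_witness[of _ PN children])
         (auto simp: Suc PN)
    also have "\<dots> = (\<Sum>k\<in>{0..m}. \<Sum>ts\<in>{ts\<in>{ts. forest_nodes ts = m}. length ts = k}.
          q (length ts) * prod_list (map (weight q) ts))"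
      using length_le_forest_nodes
      by (intro sum.group[symmetric]) (auto simp: finite_forest_nodes_eq)
    also have "\<dots> = (\<Sum>k=0..m. q k * fps_nth (progeny_fps q ^ k) m)"
      unfolding progeny_fps_power_nth sum_distrib_left
      by (intro sum.cong refl) auto
    finally show ?thesis by (simp add: Suc fps_compose_nth)
  qed
qed

subsection \<open>The offspring distribution\<close>

text \<open>The generating function is prescribed only on \<open>[0,1]\<close>, so the sum is
  assumed to vanish only to the right of 0. A nonzero coefficient would make it nonzero on a
  punctured neighbourhood of 0, which contains positive points.\<close>

lemma powser_eq_0_right_imp_0:
  fixes c :: "nat \<Rightarrow> real"
  assumes summ: "\<And>z. \<bar>z\<bar> < 1 \<Longrightarrow> summable (\<lambda>k. c k * z ^ k)"
    and zero: "\<And>z. 0 \<le> z \<Longrightarrow> z < 1 \<Longrightarrow> (\<Sum>k. c k * z ^ k) = 0"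
  shows "c m = 0"
proof (rule ccontr)
  assume m: "c m \<noteq> 0"
  have "c 0 = 0" using zero[of 0] by simp
  hence "m > 0" using m by (cases m) auto
  obtain s where s: "s > 0" "\<And>z. z \<in> cball 0 s - {0} \<Longrightarrow> (\<Sum>k. c k * z ^ k) \<noteq> 0"
    by (rule powser_0_nonzero[of 1 0 c "\<lambda>z. \<Sum>k. c k * z ^ k" m])
       (use summ zero[of 0] m \<open>m > 0\<close> in \<open>auto simp: summable_sums\<close>)
  define z where "z = min s (1/2)"
  have "0 < z" "z \<le> s" "z < 1" using s(1) by (auto simp: z_def)
  thus False using s(2)[of z] zero[of z] by simp
qed

text \<open>Both power series agree on \<open>[0,1)\<close>, hence coefficientwise. Composition with
  \<open>- fps_X\<close> encodes the binomial series of \<open>(1 - z) powr a\<close>.\<close>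

lemma IGW_offspring_pmf:
  assumes "has_pgf p (\<lambda>z. z + q * (1 - z) powr a)"
  shows "pmf p k = fps_nth (fps_X + fps_const q * (fps_binomial a oo - fps_X)) k"
proof -
  define b where "b k = fps_nth (fps_X + fps_const q * (fps_binomial a oo - fps_X)) k" for k
  have b: "(\<lambda>k. b k * z ^ k) sums (z + q * (1 - z) powr a)" if "\<bar>z\<bar> < 1" for z
  proof -
    have "(\<lambda>k. if k = 1 then z ^ k else 0) sums (z ^ 1)" by (rule sums_single)
    moreover have "(\<lambda>k. q * ((a gchoose k) * (- z) ^ k)) sums (q * (1 + (- z)) powr a)"
      using that by (intro sums_mult gen_binomial_real) simp
    ultimately have "(\<lambda>k. (if k = 1 then z ^ k else 0) + q * ((a gchoose k) * (- z) ^ k))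
        sums (z ^ 1 + q * (1 + (- z)) powr a)" by (rule sums_add)
    moreover have "(if k = 1 then z ^ k else 0) + q * ((a gchoose k) * (- z) ^ k) = b k * z ^ k" for k
      by (auto simp: b_def fps_compose_uminus' power_minus[of z] algebra_simps)
    ultimately show ?thesis by simp
  qed
  have p: "summable (\<lambda>k. pmf p k * z ^ k)" if "\<bar>z\<bar> < 1" for z
  proof (rule summable_comparison_test')
    show "summable (\<lambda>k. \<bar>z\<bar> ^ k)" using that by (simp add: summable_geometric)
    show "norm (pmf p k * z ^ k) \<le> \<bar>z\<bar> ^ k" if "k \<ge> 0" for k
      by (simp add: abs_mult power_abs pmf_le_1 mult_left_le_one_le)
  qed
  have "pmf p k - b k = 0"
  proof (rule powser_eq_0_right_imp_0)
    fix z :: real assume "\<bar>z\<bar> < 1"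
    thus "summable (\<lambda>k. (pmf p k - b k) * z ^ k)"
      using summable_diff[OF p b[THEN sums_summable]] by (simp add: algebra_simps)
  next
    fix z :: real assume z: "0 \<le> z" "z < 1"
    hence "(\<lambda>k. pmf p k * z ^ k - b k * z ^ k) sums
        ((z + q * (1 - z) powr a) - (z + q * (1 - z) powr a))"
      using assms by (intro sums_diff b) (auto simp: has_pgf_def)
    thus "(\<Sum>k. (pmf p k - b k) * z ^ k) = 0"
      by (simp add: algebra_simps sums_iff)
  qed
  thus ?thesis by (simp add: b_def)
qed

subsection \<open>The Galton-Watson measure\<close>

lemma edges_Node_empty [simp]: "edges (Node {#}) = {#}"
  by simp

lemma edges_Node_add [simp]:
  "edges (Node (add_mset (l, t) E)) = add_mset l (edges t + edges (Node E))"
  by simp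

declare edges.simps [simp del]

section \<open>Shapes as planar trees with the birth order forgotten\<close>

primrec forget :: "ptree \<Rightarrow> unit rtree" where
  "forget (PN ts) = Node (image_mset (Pair ()) (mset (map forget ts)))"

text \<open>Each node except the root owns exactly one edge, the one to its parent.\<close>

lemma Suc_size_edges_forget: "Suc (size (edges (forget t))) = nodes t"
proof (induction t)
  case (PN ts)
  hence "size (edges (Node (image_mset (Pair ()) (mset (map forget ts))))) = forest_nodes ts"
  proof (induction ts)
    case (Cons t ts)
    have "Suc (size (edges (forget t))) = nodes t" by (rule Cons.prems) simp
    with Cons show ?case by simp
  qed simp
  thus ?case by simp
qed

text \<open>Any enumeration of the multisets of children yields a planar preimage.\<close>

lemma surj_forget: "\<exists>t. forget t = \<tau>"
proof (induction \<tau>)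
  case (Node E)
  have "\<forall>t\<in>snd ` set_mset E. \<exists>t'. forget t' = t"
    using Node by (force simp: snds.simps)
  then obtain g where g: "\<And>t. t \<in> snd ` set_mset E \<Longrightarrow> forget (g t) = t" by metis
  obtain xs where xs: "E = mset xs" by (metis ex_mset)
  have "map (\<lambda>x. ((), forget (g (snd x)))) xs = xs"
    by (rule map_idI) (auto simp: g xs intro: prod_eqI)
  hence "forget (PN (map (g \<circ> snd) xs)) = Node E"
    by (simp add: xs comp_def flip: mset_map)
  thus ?case ..
qed

text \<open>A vertex with a single child contributes the factor \<open>q 1\<close> to the
  weight.\<close>

lemma no_unary_forget:
  assumes "q 1 = 0" "weight q t \<noteq> 0"
  shows "no_unary (forget t)"
  using assms(2)
proof (induction t)
  case (PN ts)
  have "no_unary (forget t)" if "t \<in> set ts" for t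
    using PN.IH[OF that] PN.prems that by (force simp: prod_list_zero_iff)
  moreover have "length ts \<noteq> 1" using PN.prems assms(1) by auto
  ultimately show ?case by (auto intro!: no_unary.intros)
qed

lemma weight_nonneg: "(\<And>k. 0 \<le> q k) \<Longrightarrow> 0 \<le> weight q t"
  by (induction t) (auto intro!: mult_nonneg_nonneg prod_list_nonneg)

text \<open>The pairs (individual, number of offspring) prescribed by a planar genealogy rooted at an
  individual.\<close>

primrec degrees :: "ptree \<Rightarrow> nat list \<Rightarrow> (nat list \<times> nat) set" where
  "degrees (PN ts) = (\<lambda>u. insert (u, length ts)
     (\<Union>(i, f)\<in>set (zip [0..<length ts] (map degrees ts)). f (u @ [i])))"

text \<open>The definition zips positions with recursive results to stay primitive recursive; the
  indexed union is the form suited to proofs.\<close>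

lemma degrees_PN:
  "degrees (PN ts) u = insert (u, length ts) (\<Union>i<length ts. degrees (ts ! i) (u @ [i]))"
  by (auto simp: set_zip)

declare degrees.simps [simp del]

lemma ptree_nth_induct [case_names PN]:
  assumes "\<And>ts. (\<And>i. i < length ts \<Longrightarrow> P (ts ! i)) \<Longrightarrow> P (PN ts)"
  shows "P t"
  by (induction t) (auto intro!: assms)

lemma finite_degrees [simp]: "finite (degrees t u)"
  by (induction t arbitrary: u rule: ptree_nth_induct) (auto simp: degrees_PN)

lemma degrees_prefix: "x \<in> degrees t u \<Longrightarrow> \<exists>w. fst x = u @ w"
proof (induction t arbitrary: u rule: ptree_nth_induct)
  case (PN ts)
  thus ?case by (fastforce simp: degrees_PN)
qed

text \<open>Descendants of different siblings differ in the letter that follows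
  \<open>u\<close>.\<close>

lemma degrees_child_disjoint:
  assumes "x \<in> degrees t (u @ [i])" "y \<in> degrees t' (u @ [j])" "fst x = fst y"
  shows "i = j"
  using assms degrees_prefix[of x t "u @ [i]"] degrees_prefix[of y t' "u @ [j]"] by auto

lemma degrees_child_not_root: "x \<in> degrees t (u @ [i]) \<Longrightarrow> fst x \<noteq> u"
  using degrees_prefix[of x t "u @ [i]"] by auto

text \<open>No individual is assigned two offspring numbers, so a planar genealogy constrains
  distinct, hence independent, coordinates of the process.\<close>

lemma inj_on_fst_degrees: "inj_on fst (degrees t u)"
proof (induction t arbitrary: u rule: ptree_nth_induct)
  case (PN ts)
  show ?case
  proof (rule inj_onI)
    fix x y assume xy: "x \<in> degrees (PN ts) u" "y \<in> degrees (PN ts) u" "fst x = fst y"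
    show "x = y"
    proof (cases "fst x = u")
      case True
      have "z = (u, length ts)" if "z \<in> degrees (PN ts) u" "fst z = u" for z
        using that degrees_child_not_root[of z _ u] by (auto simp: degrees_PN)
      thus ?thesis using xy True by metis
    next
      case False
      then obtain i j where ij: "i < length ts" "x \<in> degrees (ts ! i) (u @ [i])"
          "j < length ts" "y \<in> degrees (ts ! j) (u @ [j])"
        using xy by (auto simp: degrees_PN)
      hence "i = j" using degrees_child_disjoint xy(3) by blast
      thus ?thesis using PN[OF ij(1), of "u @ [i]"] ij xy(3) by (auto dest: inj_onD)
    qed
  qed
qed

lemma prod_degrees:
  "(\<Prod>(v, k)\<in>degrees (PN ts) u. f v k)
    = (f u (length ts) :: real) * (\<Prod>i<length ts. \<Prod>(v, k)\<in>degrees (ts ! i) (u @ [i]). f v k)"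
proof -
  have "(u, length ts) \<notin> (\<Union>i<length ts. degrees (ts ! i) (u @ [i]))"
    using degrees_child_not_root by fastforce
  moreover have "\<forall>i\<in>{..<length ts}. \<forall>j\<in>{..<length ts}. i \<noteq> j \<longrightarrow>
      degrees (ts ! i) (u @ [i]) \<inter> degrees (ts ! j) (u @ [j]) = {}"
    using degrees_child_disjoint by blast
  ultimately show ?thesis
    unfolding degrees_PN by (simp add: prod.UNION_disjoint)
qed

text \<open>Only the progenitor has an offspring law of its own; strictly below it every factor
  comes from \<open>q\<close>.\<close>

lemma prod_degrees_weight:
  assumes "\<And>w. w \<noteq> [] \<Longrightarrow> f w = q" "u \<noteq> []"
  shows "(\<Prod>(v, k)\<in>degrees t u. f v k) = weight q t"
  using assms(2)
proof (induction t arbitrary: u rule: ptree_nth_induct)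
  case (PN ts)
  have "prod_list (map (weight q) ts) = (\<Prod>i<length ts. weight q (ts ! i))"
    by (simp add: prod.list_conv_set_nth atLeast0LessThan)
  thus ?case using PN by (simp add: prod_degrees assms(1))
qed

section \<open>Genealogies as cylinder events\<close>

definition planar_family :: "(nat list \<Rightarrow> nat) \<Rightarrow> nat list \<Rightarrow> ptree \<Rightarrow> bool" where
  "planar_family \<omega> u t \<longleftrightarrow> (\<forall>(v, k)\<in>degrees t u. \<omega> v = k)"

lemma planar_family_PN:
  "planar_family \<omega> u (PN ts)
    \<longleftrightarrow> \<omega> u = length ts \<and> (\<forall>i<length ts. planar_family \<omega> (u @ [i]) (ts ! i))"
  by (auto simp: planar_family_def degrees_PN)

text \<open>This makes the cylinder events of different planar trees disjoint.\<close>

lemma planar_family_unique: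
  "planar_family \<omega> u t \<Longrightarrow> planar_family \<omega> u t' \<Longrightarrow> t = t'"
proof (induction t arbitrary: u t' rule: ptree_nth_induct)
  case (PN ts)
  obtain ts' where ts': "t' = PN ts'" by (cases t')
  have "ts = ts'"
    using PN.prems PN.IH unfolding ts' planar_family_PN
    by (intro nth_equalityI) auto
  thus ?case by (simp add: ts')
qed

lemma mset_map_conv_mset_set: "image_mset f (mset_set {..<n}) = mset (map f [0..<n])"
  by (simp add: mset_upt atLeast0LessThan)

text \<open>The birth order recorded in \<open>\<omega>\<close> selects a planar version of the
  family tree, so the events defining \<open>GW\<close> become unions of cylinder events.\<close>

lemma family_tree_iff: "family_tree \<omega> u \<tau> \<longleftrightarrow> (\<exists>t. planar_family \<omega> u t \<and> forget t = \<tau>)"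
proof
  assume "family_tree \<omega> u \<tau>"
  thus "\<exists>t. planar_family \<omega> u t \<and> forget t = \<tau>"
  proof (induction rule: family_tree.induct)
    case (1 u f)
    then obtain g where
      g: "\<And>i. i < \<omega> u \<Longrightarrow> planar_family \<omega> (u @ [i]) (g i) \<and> forget (g i) = f i"
      by metis
    have "forget (PN (map g [0..<\<omega> u])) = Node (mset (map (\<lambda>i. ((), forget (g i))) [0..<\<omega> u]))"
      by (simp add: comp_def flip: mset_map)
    also have "map (\<lambda>i. ((), forget (g i))) [0..<\<omega> u] = map (\<lambda>i. ((), f i)) [0..<\<omega> u]"
      using g by simp
    finally have "forget (PN (map g [0..<\<omega> u]))
        = Node (image_mset (\<lambda>i. ((), f i)) (mset_set {..<\<omega> u}))"
      by (simp add: mset_map_conv_mset_set)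
    moreover have "planar_family \<omega> u (PN (map g [0..<\<omega> u]))"
      using g by (simp add: planar_family_PN)
    ultimately show ?case by blast
  qed
next
  assume "\<exists>t. planar_family \<omega> u t \<and> forget t = \<tau>"
  then obtain t where "planar_family \<omega> u t" "forget t = \<tau>" by blast
  thus "family_tree \<omega> u \<tau>"
  proof (induction t arbitrary: u \<tau> rule: ptree_nth_induct)
    case (PN ts)
    have len: "\<omega> u = length ts" using PN.prems by (simp add: planar_family_PN)
    have "family_tree \<omega> u (Node (image_mset (\<lambda>i. ((), forget (ts ! i))) (mset_set {..<\<omega> u})))"
      using PN by (intro family_tree.intros) (auto simp: planar_family_PN)
    also have "image_mset (\<lambda>i. ((), forget (ts ! i))) (mset_set {..<\<omega> u})
        = mset (map (\<lambda>t. ((), forget t)) (map ((!) ts) [0..<length ts]))"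
      by (simp add: mset_map_conv_mset_set len comp_def del: mset_map)
    also have "\<dots> = image_mset (Pair ()) (mset (map forget ts))"
      by (simp only: map_nth) (simp add: comp_def multiset.map_comp)
    finally show ?case using PN.prems(2) by simp
  qed
qed

lemma planted_trees_forget:
  "Node {#((), forget t)#} \<in> planted_trees \<longleftrightarrow> no_unary (forget t)"
  by (auto simp: planted_trees_def)

lemma
  fixes p :: "nat pmf"
  shows planar_family_measurable:
      "{\<omega> \<in> space (gw_process p). planar_family \<omega> u t} \<in> sets (gw_process p)" (is ?meas)
    and emeasure_planar_family:
      "emeasure (gw_process p) {\<omega> \<in> space (gw_process p). planar_family \<omega> u t}
        = ennreal (\<Prod>(v, k)\<in>degrees t u. pmf (if v = [] then return_pmf 1 else p) k)" (is ?emeas)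
proof -
  let ?r = "\<lambda>v::nat list. if v = [] then return_pmf 1 else p"
  interpret product_prob_space "\<lambda>v. measure_pmf (?r v)" UNIV
    by unfold_locales
  \<comment> \<open>The values allowed at coordinate \<open>v\<close>. Since \<open>fst\<close> is
    injective on the prescribed pairs, each constrained coordinate has exactly one, and the product
    over individuals becomes a product over pairs.\<close>
  define X where "X v = {k. (v, k) \<in> degrees t u}" for v
  have X: "X (fst x) = {snd x}" if x: "x \<in> degrees t u" for x
  proof -
    have "k = snd x" if "(fst x, k) \<in> degrees t u" for k
      using inj_onD[OF inj_on_fst_degrees, of "(fst x, k)" x t u] that x by (metis fst_conv snd_conv)
    thus ?thesis using x by (auto simp: X_def)
  qed
  have "planar_family \<omega> u t \<longleftrightarrow> (\<forall>v\<in>fst ` degrees t u. \<omega> v \<in> X v)" for \<omega>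
    by (simp add: planar_family_def case_prod_beta X cong: ball_cong)
  hence eq: "{\<omega> \<in> space (gw_process p). planar_family \<omega> u t}
      = {\<omega> \<in> space (Pi\<^sub>M UNIV (\<lambda>v. measure_pmf (?r v))). \<forall>v\<in>fst ` degrees t u. \<omega> v \<in> X v}"
    by (simp add: gw_process_def)
  show ?meas
    unfolding eq unfolding gw_process_def by measurable
  have "emeasure (gw_process p) {\<omega> \<in> space (gw_process p). planar_family \<omega> u t}
      = (\<Prod>v\<in>fst ` degrees t u. emeasure (measure_pmf (?r v)) (X v))"
    unfolding eq unfolding gw_process_def by (intro emeasure_PiM_Collect) auto
  also have "\<dots> = (\<Prod>x\<in>degrees t u. emeasure (measure_pmf (?r (fst x))) (X (fst x)))"
    by (simp add: prod.reindex[OF inj_on_fst_degrees])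
  also have "\<dots> = (\<Prod>(v, k)\<in>degrees t u. ennreal (pmf (?r v) k))"
    by (intro prod.cong refl) (simp add: X emeasure_pmf_single case_prod_beta)
  finally show ?emeas
    by (simp add: case_prod_beta prod_ennreal)
qed

text \<open>The law \<open>return_pmf 1\<close> of the progenitor forces a single child, at
  \<open>[0]\<close>; from there on the offspring law is \<open>p\<close>, which gives the
  weight.\<close>

lemma emeasure_root_planar_family:
  "emeasure (gw_process p) {\<omega> \<in> space (gw_process p). planar_family \<omega> [] (PN ts)}
    = (if length ts = 1 then ennreal (weight (pmf p) (hd ts)) else 0)"
proof -
  have "(\<Prod>(v, k)\<in>degrees (ts ! 0) [0]. pmf (if v = [] then return_pmf 1 else p) k)
      = weight (pmf p) (ts ! 0)"
    by (rule prod_degrees_weight) auto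
  thus ?thesis
    unfolding emeasure_planar_family prod_degrees
    by (cases ts) (auto simp: lessThan_Suc indicator_def)
qed

section \<open>The law of the number of edges\<close>

lemma finite_trees_edges_eq: "finite {\<tau> :: unit rtree. size (edges \<tau>) = n}"
proof (rule finite_subset)
  show "{\<tau>. size (edges \<tau>) = n} \<subseteq> forget ` {t. nodes t = Suc n}"
  proof
    fix \<tau> assume \<tau>: "\<tau> \<in> {\<tau> :: unit rtree. size (edges \<tau>) = n}"
    obtain t where "forget t = \<tau>" using surj_forget by blast
    thus "\<tau> \<in> forget ` {t. nodes t = Suc n}"
      using Suc_size_edges_forget[of t] \<tau> by auto
  qed
qed (simp add: finite_nodes_eq)

text \<open>The progenitor is not counted: a planted tree with \<open>n\<close> edges is the shape
  of \<open>PN [t]\<close> where \<open>t\<close> has \<open>n\<close> nodes. For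
  \<open>n = 0\<close> both sides are 0.\<close>

theorem emeasure_GW_size_edges:
  assumes "pmf p 1 = 0"
  shows "emeasure (GW p) {\<tau> \<in> planted_trees. size (edges \<tau>) = n}
    = ennreal (fps_nth (progeny_fps (pmf p)) n)"
proof -
  define S where "S = {\<tau> \<in> planted_trees. size (edges (\<tau> :: unit rtree)) = n}"
  define E where "E t = {\<omega> \<in> space (gw_process p). planar_family \<omega> [] t}" for t
  define I where "I = {t. nodes t = Suc n \<and> forget t \<in> planted_trees}"
  have "finite S" unfolding S_def by (rule finite_subset[OF _ finite_trees_edges_eq[of n]]) auto
  have "finite I" unfolding I_def by (rule finite_subset[OF _ finite_nodes_eq[of "Suc n"]]) auto
  have E: "E t \<in> sets (gw_process p)" for t
    unfolding E_def by (rule planar_family_measurable)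
  \<comment> \<open>A shape has finitely many planar versions, and their cylinder events are
    disjoint.\<close>
  have fibre: "emeasure (gw_process p) {\<omega> \<in> space (gw_process p). family_tree \<omega> [] \<tau>}
      = (\<Sum>t\<in>{t\<in>I. forget t = \<tau>}. emeasure (gw_process p) (E t))" if "\<tau> \<in> S" for \<tau>
  proof -
    have "{\<omega> \<in> space (gw_process p). family_tree \<omega> [] \<tau>} = (\<Union>t\<in>{t\<in>I. forget t = \<tau>}. E t)"
      using that by (auto simp: E_def I_def S_def family_tree_iff simp flip: Suc_size_edges_forget)
    moreover have "disjoint_family_on E {t\<in>I. forget t = \<tau>}"
      by (auto simp: disjoint_family_on_def E_def dest: planar_family_unique)
    ultimately show ?thesis
      using E \<open>finite I\<close> by (simp add: sum_emeasure image_subset_iff)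
  qed
  have "emeasure (GW p) S = (\<integral>\<^sup>+\<tau>\<in>S. emeasure (gw_process p)
      {\<omega> \<in> space (gw_process p). family_tree \<omega> [] \<tau>} \<partial>count_space planted_trees)"
    unfolding GW_def by (rule emeasure_density) (auto simp: S_def)
  also have "\<dots> = (\<Sum>\<tau>\<in>S. emeasure (gw_process p)
      {\<omega> \<in> space (gw_process p). family_tree \<omega> [] \<tau>})"
    using \<open>finite S\<close>
    by (subst nn_integral_count_space'[of S]) (auto simp: S_def indicator_def)
  also have "\<dots> = (\<Sum>\<tau>\<in>S. \<Sum>t\<in>{t\<in>I. forget t = \<tau>}. emeasure (gw_process p) (E t))"
    by (intro sum.cong refl fibre)
  also have "\<dots> = (\<Sum>t\<in>I. emeasure (gw_process p) (E t))"
    using \<open>finite S\<close> \<open>finite I\<close>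
    by (intro sum.group) (auto simp: I_def S_def simp flip: Suc_size_edges_forget)
  \<comment> \<open>Planar trees whose root does not have exactly one child carry no mass. The
    others are \<open>PN [t]\<close>, whose shape is planted exactly when \<open>forget t\<close>
    has no unary vertex.\<close>
  also have "\<dots> = (\<Sum>t\<in>(\<lambda>t. PN [t]) ` {t. nodes t = n \<and> no_unary (forget t)}.
      emeasure (gw_process p) (E t))"
  proof (rule sum.mono_neutral_right)
    show "\<forall>t\<in>I - (\<lambda>t. PN [t]) ` {t. nodes t = n \<and> no_unary (forget t)}.
        emeasure (gw_process p) (E t) = 0"
    proof
      fix t assume t: "t \<in> I - (\<lambda>t. PN [t]) ` {t. nodes t = n \<and> no_unary (forget t)}"
      obtain ts where ts: "t = PN ts" by (cases t)
      have "length ts \<noteq> 1"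
        using t by (auto simp: ts I_def length_Suc_conv planted_trees_forget)
      thus "emeasure (gw_process p) (E t) = 0"
        by (simp add: E_def ts emeasure_root_planar_family)
    qed
  qed (use \<open>finite I\<close> in \<open>auto simp: I_def planted_trees_forget\<close>)
  also have "\<dots> = (\<Sum>t | nodes t = n \<and> no_unary (forget t). ennreal (weight (pmf p) t))"
    by (subst sum.reindex) (auto simp: inj_on_def E_def emeasure_root_planar_family)
  \<comment> \<open>Trees with a unary vertex can be added back because \<open>pmf p 1 = 0\<close>
    gives them weight 0.\<close>
  also have "\<dots> = (\<Sum>t | nodes t = n. ennreal (weight (pmf p) t))"
  proof (rule sum.mono_neutral_left)
    have "weight (pmf p) t = 0" if "\<not> no_unary (forget t)" for t
      using that no_unary_forget[of "pmf p" t] assms by blast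
    thus "\<forall>t\<in>{t. nodes t = n} - {t. nodes t = n \<and> no_unary (forget t)}.
        ennreal (weight (pmf p) t) = 0"
      by simp
  qed (auto simp: finite_nodes_eq)
  also have "\<dots> = ennreal (fps_nth (progeny_fps (pmf p)) n)"
    by (simp add: progeny_fps_def weight_nonneg sum_ennreal)
  finally show ?thesis by (simp add: S_def)
qed

subsection \<open>Metric trees\<close>

lemma edges_map_rtree: "edges (map_rtree f e) = image_mset f (edges e)"
proof (induction e)
  case (Node E)
  have "edges (Node (image_mset (map_prod f (map_rtree f)) E)) = image_mset f (edges (Node E))"
    using Node
  proof (induction E)
    case (add x E)
    obtain l t where x: "x = (l, t)" by (cases x)
    have "edges (map_rtree f t) = image_mset f (edges t)"
      by (rule add.prems[of x]) (auto simp: x)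
    moreover have "edges (Node (image_mset (map_prod f (map_rtree f)) E))
        = image_mset f (edges (Node E))"
      by (rule add.IH) (use add.prems in auto)
    ultimately show ?case by (simp add: x)
  qed simp
  thus ?case by simp
qed

lemma set_rtree_eq_edges: "set_rtree e = set_mset (edges e)"
proof (induction e)
  case (Node E)
  have "set_rtree (Node E) = set_mset (edges (Node E))"
    using Node
  proof (induction E)
    case (add x E)
    obtain l t where x: "x = (l, t)" by (cases x)
    have "set_rtree t = set_mset (edges t)"
      by (rule add.prems[of x]) (auto simp: x)
    moreover have "set_rtree (Node E) = set_mset (edges (Node E))"
      by (rule add.IH) (use add.prems in auto)
    ultimately show ?case by (simp add: x Un_assoc)
  qed simp
  thus ?case .
qed

lemma shape_map_rtree [simp]: "shape (map_rtree f e) = shape e"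
  by (simp add: shape_def rtree.map_comp comp_def)

lemma size_edges_shape [simp]: "size (edges (shape e)) = size (edges e)"
  by (simp add: shape_def edges_map_rtree)

lemma no_unary_map_rtree: "no_unary (map_rtree f e) \<longleftrightarrow> no_unary e"
proof (induction e)
  case (Node E)
  have "no_unary (map_rtree f t) \<longleftrightarrow> no_unary t" if "(l, t) \<in># E" for l t
    by (rule Node[OF that]) simp
  thus ?case
    by (fastforce simp: no_unary.simps[of "Node _"])
qed

lemma planted_trees_map_rtree: "map_rtree f e \<in> planted_trees \<longleftrightarrow> e \<in> planted_trees"
proof (cases e)
  case (Node E)
  show ?thesis
  proof (cases "size E = 1")
    case True
    then obtain l t where "E = {#(l, t)#}" by (metis size_1_singleton_mset surj_pair)
    thus ?thesis by (auto simp: Node planted_trees_def no_unary_map_rtree)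
  next
    case False
    hence "E \<noteq> {#x#}" "image_mset (map_prod f (map_rtree f)) E \<noteq> {#y#}" for x y
      by (auto dest: arg_cong[of _ _ size])
    thus ?thesis by (auto simp: Node planted_trees_def)
  qed
qed

lemma planted_trees_shape [simp]: "shape e \<in> planted_trees \<longleftrightarrow> e \<in> planted_trees"
  by (simp add: shape_def planted_trees_map_rtree)

lemma metric_trees_map_rtree:
  "map_rtree x e \<in> metric_trees \<longleftrightarrow> e \<in> planted_trees \<and> (\<forall>i\<in>set_rtree e. 0 < x i)"
  by (auto simp: metric_trees_def planted_trees_map_rtree rtree.set_map)

lemma distinct_edges_imp_eq_mset_set:
  "distinct_edges e \<Longrightarrow> edges e = mset_set (set_rtree e)"
  by (rule multiset_eqI)
     (simp add: distinct_edges_def set_rtree_eq_edges count_mset_set' le_Suc_eq count_eq_zero_iff)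

lemma tree_length_map_rtree:
  "distinct_edges e \<Longrightarrow> tree_length (map_rtree x e) = (\<Sum>i\<in>set_rtree e. x i)"
  by (simp add: tree_length_def edges_map_rtree distinct_edges_imp_eq_mset_set sum_unfold_sum_mset)

lemma card_set_rtree: "distinct_edges e \<Longrightarrow> card (set_rtree e) = size (edges e)"
  by (metis distinct_edges_imp_eq_mset_set size_mset_set)

lemma finite_set_rtree [simp]: "finite (set_rtree e)"
  by (simp add: set_rtree_eq_edges)

lemma exists_distinct_naming:
  "\<exists>e :: nat rtree. shape e = \<tau> \<and> distinct_edges e"
proof -
  \<comment> \<open>The lower bound \<open>k\<close> on the labels strengthens the induction, so
    that separate branches can receive disjoint ranges of labels.\<close>
  have "\<exists>e :: nat rtree. shape e = \<tau> \<and> distinct_edges e \<and> (\<forall>i\<in>#edges e. k \<le> i)" for k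
  proof (induction \<tau> arbitrary: k)
    case (Node E)
    thus ?case
    proof (induction E arbitrary: k)
      case empty
      show ?case by (intro exI[of _ "Node {#}"]) (simp add: shape_def distinct_edges_def)
    next
      case (add x E)
      obtain t where x: "x = ((), t)" by (cases x) auto
      have "\<exists>e :: nat rtree. shape e = Node E \<and> distinct_edges e \<and> (\<forall>i\<in>#edges e. k \<le> i)"
        by (rule add.IH) (use add.prems in auto)
      then obtain e where e: "shape e = Node E" "distinct_edges e" "\<forall>i\<in>#edges e. k \<le> i"
        by blast
      obtain E' where E': "e = Node E'" by (cases e)
      \<comment> \<open>\<open>m\<close> exceeds all labels used so far and names the new edge; the
        subtree below that edge is named from \<open>Suc m\<close> on.\<close>
      obtain m where m: "\<forall>i\<in>#edges e. i < m" "k \<le> m"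
        by (rule that[of "Suc (Max (insert k (set_mset (edges e))))"])
           (auto simp: less_Suc_eq_le le_SucI)
      have "\<exists>e' :: nat rtree. shape e' = t \<and> distinct_edges e' \<and> (\<forall>i\<in>#edges e'. Suc m \<le> i)"
        by (rule add.prems[of x]) (auto simp: x)
      then obtain e' where e': "shape e' = t" "distinct_edges e'" "\<forall>i\<in>#edges e'. Suc m \<le> i"
        by blast
      show ?case
      proof (intro exI[of _ "Node (add_mset (m, e') E')"] conjI)
        show "shape (Node (add_mset (m, e') E')) = Node (add_mset x E)"
          using e(1) e'(1) by (simp add: x E' shape_def)
        have "count (edges (Node (add_mset (m, e') E'))) i \<le> 1" for i
        proof -
          have "count (edges e) i = 0" if "i \<ge> m" using m(1) that by (auto simp: count_eq_zero_iff)
          moreover have "count (edges e') i = 0" if "i \<le> m"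
            using e'(3) that by (auto simp: count_eq_zero_iff)
          ultimately show ?thesis
            using e(2) e'(2) unfolding E' distinct_edges_def
            by (cases i m rule: linorder_cases) auto
        qed
        thus "distinct_edges (Node (add_mset (m, e') E'))" by (simp add: distinct_edges_def)
        show "\<forall>i\<in>#edges (Node (add_mset (m, e') E')). k \<le> i"
          using e(3) e'(3) m by (force simp: E')
      qed
    qed
  qed
  thus ?thesis by blast
qed

section \<open>Measurability of length and shape\<close>

lemma space_metric_tree_space [simp]: "space metric_tree_space = metric_trees"
  by (auto simp: metric_tree_space_def space_measure_of_conv)

text \<open>In a chart the length is a sum of coordinates and the shape is constant, so the preimage
  is either empty or cut out by measurable conditions. Taking one condition trivial yields the
  measurability of each map.\<close>

lemma metric_tree_space_length_shape:
  assumes B: "B \<in> sets borel"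
  shows "{T \<in> metric_trees. tree_length T \<in> B \<and> shape T \<in> S} \<in> sets metric_tree_space"
proof -
  let ?A = "{T \<in> metric_trees. tree_length T \<in> B \<and> shape T \<in> S}"
  have "{x \<in> space (\<Pi>\<^sub>M i\<in>set_rtree e. borel). map_rtree x e \<in> ?A}
      \<in> sets (\<Pi>\<^sub>M i\<in>set_rtree e. borel)" if e: "distinct_edges (e :: nat rtree)" for e
  proof (cases "e \<in> planted_trees \<and> shape e \<in> S")
    case True
    hence "{x \<in> space (\<Pi>\<^sub>M i\<in>set_rtree e. borel). map_rtree x e \<in> ?A}
       = {x \<in> space (\<Pi>\<^sub>M i\<in>set_rtree e. borel).
            (\<forall>i\<in>set_rtree e. 0 < x i) \<and> (\<Sum>i\<in>set_rtree e. x i) \<in> B}"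
      by (auto simp: metric_trees_map_rtree tree_length_map_rtree[OF e])
    also have "\<dots> \<in> sets (\<Pi>\<^sub>M i\<in>set_rtree e. borel)"
      using B by measurable
    finally show ?thesis .
  next
    case False
    hence empty: "{x \<in> space (\<Pi>\<^sub>M i\<in>set_rtree e. borel). map_rtree x e \<in> ?A} = {}"
      by (auto simp: metric_trees_map_rtree)
    show ?thesis unfolding empty by simp
  qed
  hence "?A \<in> {A. A \<subseteq> metric_trees \<and> (\<forall>e :: nat rtree. distinct_edges e \<longrightarrow>
            {x \<in> space (\<Pi>\<^sub>M i\<in>set_rtree e. borel). map_rtree x e \<in> A}
              \<in> sets (\<Pi>\<^sub>M i\<in>set_rtree e. borel))}" (is "_ \<in> ?G")
    by auto
  moreover have "?G \<subseteq> Pow metric_trees" by auto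
  ultimately show ?thesis
    unfolding metric_tree_space_def by (auto simp: sets_measure_of)
qed

lemma measurable_tree_length [measurable]: "tree_length \<in> borel_measurable metric_tree_space"
proof (rule measurableI)
  fix B :: "real set" assume "B \<in> sets borel"
  thus "tree_length -` B \<inter> space metric_tree_space \<in> sets metric_tree_space"
    using metric_tree_space_length_shape[of B UNIV]
    by (simp add: vimage_def Int_def conj_commute)
qed simp

lemma measurable_shape [measurable]:
  "shape \<in> measurable metric_tree_space (count_space planted_trees)"
proof (rule measurableI)
  fix S :: "unit rtree set"
  show "shape -` S \<inter> space metric_tree_space \<in> sets metric_tree_space"
    using metric_tree_space_length_shape[of UNIV S]
    by (simp add: vimage_def Int_def conj_commute)
qed (simp add: metric_trees_def)

text \<open>\<open>erlang_density k\<close> is the density of a sum of \<open>k + 1\<close>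
  exponentials, hence the index \<open>card I - 1\<close>. Independence of the coordinates is
  obtained by comparing their joint law with the product of the marginals.\<close>

lemma
  assumes lam: "0 < lam" and I: "finite I" "I \<noteq> {}"
  shows iid_exponential_sum:
      "distributed (iid_exponential lam I) lborel (\<lambda>x. \<Sum>i\<in>I. x i) (erlang_density (card I - 1) lam)"
      (is ?sum)
    and iid_exponential_pos: "AE x in iid_exponential lam I. \<forall>i\<in>I. 0 < x i" (is ?pos)
proof -
  let ?D = "density lborel (exponential_density lam)"
  let ?P = "iid_exponential lam I"
  interpret D: prob_space ?D by (rule prob_space_exponential_density[OF lam])
  interpret P: product_prob_space "\<lambda>_. ?D" I by unfold_locales
  interpret prob_space ?P unfolding iid_exponential_def by (rule P.prob_space_axioms)
  have [measurable]: "(\<lambda>x. x i) \<in> borel_measurable ?P" if "i \<in> I" for i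
    unfolding iid_exponential_def using measurable_component_singleton[OF that, of "\<lambda>_. ?D"] by simp
  have comp: "distr ?P lborel (\<lambda>x. x i) = ?D" if "i \<in> I" for i
  proof -
    have "distr ?P lborel (\<lambda>x. x i) = distr ?P ?D (\<lambda>x. x i)"
      by (intro distr_cong) auto
    thus ?thesis using P.PiM_component[OF that] by (simp add: iid_exponential_def)
  qed
  have "indep_vars (\<lambda>_. borel) (\<lambda>i x. x i) I"
  proof (subst indep_vars_iff_distr_eq_PiM')
    have "distr ?P (\<Pi>\<^sub>M i\<in>I. borel) (\<lambda>x. \<lambda>i\<in>I. x i) = distr ?P ?P (\<lambda>x. x)"
    proof (rule distr_cong)
      show "sets (\<Pi>\<^sub>M i\<in>I. borel) = sets ?P"
        unfolding iid_exponential_def by (intro sets_PiM_cong) auto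
      \<comment> \<open>Points of the product space are already \<open>undefined\<close> outside
        \<open>I\<close>, so restriction changes nothing.\<close>
      show "(\<lambda>i\<in>I. x i) = x" if "x \<in> space ?P" for x
        using that by (auto simp: iid_exponential_def space_PiM)
    qed simp
    also have "\<dots> = (\<Pi>\<^sub>M i\<in>I. ?D)" by (simp add: distr_id2 iid_exponential_def)
    also have "\<dots> = (\<Pi>\<^sub>M i\<in>I. distr ?P borel (\<lambda>x. x i))"
    proof (rule PiM_cong[OF refl])
      fix i assume "i \<in> I"
      thus "?D = distr ?P borel (\<lambda>x. x i)"
        using comp[of i] distr_cong[of ?P ?P lborel borel "\<lambda>x. x i" "\<lambda>x. x i"] by simp
    qed
    finally show "distr ?P (\<Pi>\<^sub>M i\<in>I. borel) (\<lambda>x. \<lambda>i\<in>I. x i)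
        = (\<Pi>\<^sub>M i\<in>I. distr ?P borel (\<lambda>x. x i))" .
  qed (use I in auto)
  moreover have "distributed ?P lborel (\<lambda>x. x i) (exponential_density lam)" if "i \<in> I" for i
    unfolding distributed_def using comp[OF that] that by simp
  ultimately show ?sum
    using I lam by (intro exponential_distributed_sum) auto
  \<comment> \<open>The density vanishes on the negative axis but not at 0; that point is removed as
    a null set.\<close>
  have "AE x in ?D. 0 < x"
  proof -
    have "AE x in lborel. x \<noteq> (0 :: real)" by (rule AE_lborel_singleton)
    thus ?thesis
      by (subst AE_density) (auto simp: exponential_density_def elim!: eventually_mono)
  qed
  thus ?pos
    unfolding iid_exponential_def using I(1)
    by (intro AE_finite_allI) (auto intro!: P.AE_component)
qed

subsection \<open>Exponential power series\<close>

text \<open>Cauchy product with the series of \<open>exp (- t)\<close>: the factorials combine to a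
  binomial coefficient, and the sign comes from \<open>(- t) ^ (n - i)\<close>.\<close>

lemma
  fixes P :: "nat \<Rightarrow> real"
  assumes P: "\<And>k. \<bar>P k\<bar> \<le> 1"
  shows summable_exp_series: "summable (\<lambda>k. P k * t ^ k / fact k)" (is ?summ)
    and binomial_transform_exp_series:
      "(\<lambda>n. (\<Sum>i\<le>n. (-1) ^ (n - i) * real (n choose i) * P i) * t ^ n / fact n)
        sums (exp (- t) * (\<Sum>k. P k * t ^ k / fact k))" (is ?sums)
proof -
  have abs: "summable (\<lambda>k. norm (P k * t ^ k / fact k))"
  proof (rule summable_comparison_test')
    show "summable (\<lambda>k. norm (t ^ k /\<^sub>R fact k))" by (rule summable_norm_exp)
    fix k :: nat
    show "norm (norm (P k * t ^ k / fact k)) \<le> norm (t ^ k /\<^sub>R fact k)"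
      using P[of k] by (simp add: abs_mult divide_simps mult_left_le_one_le)
  qed
  thus ?summ by (rule summable_norm_cancel)
  have "(\<lambda>n. \<Sum>i\<le>n. (P i * t ^ i / fact i) * ((- t) ^ (n - i) /\<^sub>R fact (n - i)))
      sums ((\<Sum>k. P k * t ^ k / fact k) * (\<Sum>k. (- t) ^ k /\<^sub>R fact k))"
    by (rule Cauchy_product_sums[OF abs summable_norm_exp])
  also have "(\<lambda>n. \<Sum>i\<le>n. (P i * t ^ i / fact i) * ((- t) ^ (n - i) /\<^sub>R fact (n - i)))
      = (\<lambda>n. (\<Sum>i\<le>n. (-1) ^ (n - i) * real (n choose i) * P i) * t ^ n / fact n)"
  proof
    fix n
    have "(P i * t ^ i / fact i) * ((- t) ^ (n - i) /\<^sub>R fact (n - i))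
        = (-1) ^ (n - i) * real (n choose i) * P i * t ^ n / fact n" if "i \<le> n" for i
    proof -
      have "t ^ n = t ^ i * t ^ (n - i)" using that by (simp flip: power_add)
      thus ?thesis
        using that by (simp add: binomial_fact power_minus[of t] field_simps)
    qed
    thus "(\<Sum>i\<le>n. (P i * t ^ i / fact i) * ((- t) ^ (n - i) /\<^sub>R fact (n - i)))
        = (\<Sum>i\<le>n. (-1) ^ (n - i) * real (n choose i) * P i) * t ^ n / fact n"
      by (simp add: sum_distrib_right sum_divide_distrib)
  qed
  finally show ?sums by (simp add: exp_def mult.commute)
qed

text \<open>Convergence everywhere leaves room for the radius \<open>\<bar>t\<bar> + 1\<close>,
  inside which the series converges absolutely and can be differentiated termwise.\<close>

lemma
  fixes a :: "nat \<Rightarrow> real"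
  assumes a: "\<And>t. summable (\<lambda>n. a n * t ^ n)"
  shows summable_powser_antiderivative: "summable (\<lambda>n. a n / real (Suc n) * t ^ Suc n)" (is ?summ)
    and DERIV_powser_antiderivative:
      "((\<lambda>t. \<Sum>n. a n / real (Suc n) * t ^ Suc n) has_real_derivative (\<Sum>n. a n * t ^ n)) (at t)"
      (is ?deriv)
proof -
  have "summable (\<lambda>n. norm (a n * t ^ n))"
    by (rule powser_insidea[OF a, of _ "\<bar>t\<bar> + 1"]) simp
  hence "summable (\<lambda>n. norm (a n * t ^ n) * \<bar>t\<bar>)" by (rule summable_mult2)
  thus ?summ
  proof (rule summable_comparison_test')
    fix n :: nat
    have "norm (a n / real (Suc n) * t ^ Suc n) = norm (a n * t ^ n) * \<bar>t\<bar> / real (Suc n)"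
      by (simp add: abs_mult)
    also have "\<dots> \<le> norm (a n * t ^ n) * \<bar>t\<bar> / 1"
      by (intro divide_left_mono) auto
    finally show "norm (a n / real (Suc n) * t ^ Suc n) \<le> norm (a n * t ^ n) * \<bar>t\<bar>" by simp
  qed
  have cancel: "a n / real (Suc n) * real (Suc n) = a n" for n
    by simp
  have "t \<in> {- (\<bar>t\<bar> + 1) <..< \<bar>t\<bar> + 1}" by auto
  thus ?deriv
    using DERIV_power_series'[of "\<bar>t\<bar> + 1" "\<lambda>n. a n / real (Suc n)" t] a
    by (simp add: cancel del: of_nat_Suc power_Suc)
qed

text \<open>The Gamma quotient is a generalized binomial coefficient, the form in which Lagrange
  inversion delivers the coefficients.\<close>

lemma pdf_term_gbinomial:
  assumes "0 < q"
  shows "pdf_term q lam x (Suc n) = lam *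
    ((-1) ^ n * q ^ Suc n / real (Suc n) * ((real (Suc n) * (1 / q)) gchoose n) * (lam * x) ^ n / fact n)"
proof -
  define G where "G = Gamma (real (Suc n) / q + 1)"
  define H where "H = Gamma (real (Suc n) / q - real (Suc n) + 2)"
  have "real (Suc n) / q + 1 > 0" using assms by (intro add_nonneg_pos) auto
  hence "real (Suc n) / q + 1 \<notin> \<int>\<^sub>\<le>\<^sub>0"
    using nonpos_Ints_nonpos by fastforce
  hence "(real (Suc n) / q) gchoose n
      = Gamma (real (Suc n) / q + 1) / (fact n * Gamma (real (Suc n) / q - real n + 1))"
    by (rule gbinomial_Gamma)
  also have "real (Suc n) / q - real n + 1 = real (Suc n) / q - real (Suc n) + 2" by simp
  finally have gb: "(real (Suc n) * (1 / q)) gchoose n = G / (fact n * H)"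
    by (simp add: G_def H_def)
  have "pdf_term q lam x (Suc n)
      = (-1) ^ n * (G / (fact (Suc n) * fact n * H)) * (lam * q) ^ Suc n * x ^ n"
    by (simp add: pdf_term_def G_def H_def)
  thus ?thesis
    unfolding gb by (simp add: power_mult_distrib fact_Suc mult_ac del: of_nat_Suc)
qed

lemma cdf_term_eq_pdf_term: "cdf_term q lam x (Suc n) = pdf_term q lam x (Suc n) * x / real (Suc n)"
  unfolding pdf_term_def cdf_term_def
  by (simp add: fact_Suc divide_simps mult_ac del: of_nat_Suc)

subsection \<open>The length of the tree\<close>

text \<open>The coefficient formula is reindexed so that \<open>i\<close> stands for
  \<open>i + 1\<close> edges, as it does in \<open>erlang_density i\<close>.\<close>

lemma IGW_progeny_transform:
  assumes p: "has_pgf p (\<lambda>z. z + q * (1 - z) powr a)" and q: "q \<noteq> 0"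
  shows "(\<Sum>i\<le>n. (-1) ^ (n - i) * real (n choose i) * fps_nth (progeny_fps (pmf p)) (Suc i))
    = (-1) ^ n * q ^ Suc n / real (Suc n) * ((real (Suc n) * a) gchoose n)"
proof -
  have "Abs_fps (pmf p) = fps_X + fps_const q * (fps_binomial a oo - fps_X)"
    by (rule fps_ext) (simp add: IGW_offspring_pmf[OF p])
  hence "progeny_fps (pmf p)
      = fps_X * ((fps_X + fps_const q * (fps_binomial a oo - fps_X)) oo progeny_fps (pmf p))"
    using progeny_fps_eq[of "pmf p"] by simp
  hence "(\<Sum>m=1..Suc n. (-1) ^ (Suc n - m) * real ((Suc n - 1) choose (Suc n - m))
        * fps_nth (progeny_fps (pmf p)) m)
    = (-1) ^ (Suc n - 1) * q ^ Suc n / real (Suc n) * ((real (Suc n) * a) gchoose (Suc n - 1))"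
    by (rule total_progeny_coefficients[OF _ q]) simp
  moreover have "(\<Sum>m=1..Suc n. (-1) ^ (Suc n - m) * real ((Suc n - 1) choose (Suc n - m))
        * fps_nth (progeny_fps (pmf p)) m)
      = (\<Sum>i\<le>n. (-1) ^ (n - i) * real (n choose i) * fps_nth (progeny_fps (pmf p)) (Suc i))"
    unfolding One_nat_def sum.shift_bounds_cl_Suc_ivl atLeast0AtMost
    by (intro sum.cong refl) (simp add: binomial_symmetric[symmetric])
  ultimately show ?thesis by simp
qed

text \<open>A naming \<open>e\<close> of the edges turns the conditional law into i.i.d.
  coordinates, whose sum over the \<open>n + 1\<close> edges has an Erlang law.\<close>

lemma prob_length_given_shape:
  assumes M: "prob_space M" and T: "T \<in> measurable M metric_tree_space" and lam: "0 < lam"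
    and cond: "\<And>e A. e \<in> planted_trees \<Longrightarrow> A \<in> sets metric_tree_space \<Longrightarrow> distinct_edges e \<Longrightarrow>
        \<P>(\<omega> in M. shape (T \<omega>) = shape e) > 0 \<Longrightarrow>
        \<P>(\<omega> in M. T \<omega> \<in> A \<bar> shape (T \<omega>) = shape e)
          = \<P>(x in iid_exponential lam (set_rtree e). map_rtree x e \<in> A)"
    and \<tau>: "\<tau> \<in> planted_trees" "size (edges \<tau>) = Suc n" and B: "B \<in> sets borel"
  shows "\<P>(\<omega> in M. tree_length (T \<omega>) \<in> B \<and> shape (T \<omega>) = \<tau>)
    = \<P>(\<omega> in M. shape (T \<omega>) = \<tau>) * measure (density lborel (erlang_density n lam)) B"
proof -
  interpret prob_space M by fact
  note [measurable] = T B
  have [measurable]: "(\<lambda>\<omega>. shape (T \<omega>)) \<in> measurable M (count_space planted_trees)"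
    using measurable_compose[OF T measurable_shape] .
  have [measurable]: "(\<lambda>\<omega>. tree_length (T \<omega>)) \<in> borel_measurable M"
    using measurable_compose[OF T measurable_tree_length] .
  have shape_meas: "{\<omega> \<in> space M. shape (T \<omega>) = \<tau>} \<in> sets M"
    using \<tau>(1) by measurable
  show ?thesis
  proof (cases "\<P>(\<omega> in M. shape (T \<omega>) = \<tau>) > 0")
    \<comment> \<open>The conditional law is prescribed only for shapes of positive probability; for
      the others both sides are 0.\<close>
    case False
    hence "\<P>(\<omega> in M. shape (T \<omega>) = \<tau>) = 0"
      using measure_nonneg[of M "{\<omega> \<in> space M. shape (T \<omega>) = \<tau>}"] by linarith
    moreover have "\<P>(\<omega> in M. tree_length (T \<omega>) \<in> B \<and> shape (T \<omega>) = \<tau>)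
        \<le> \<P>(\<omega> in M. shape (T \<omega>) = \<tau>)"
      by (rule finite_measure_mono[OF _ shape_meas]) auto
    ultimately show ?thesis
      using measure_nonneg[of M "{\<omega> \<in> space M. tree_length (T \<omega>) \<in> B \<and> shape (T \<omega>) = \<tau>}"] by simp
  next
    case True
    obtain e :: "nat rtree" where e: "shape e = \<tau>" "distinct_edges e"
      using exists_distinct_naming by blast
    let ?I = "set_rtree e"
    let ?P = "iid_exponential lam ?I"
    let ?A = "{T \<in> metric_trees. tree_length T \<in> B}"
    have planted: "e \<in> planted_trees" using e(1) \<tau>(1) planted_trees_shape by blast
    have card: "card ?I = Suc n" using card_set_rtree[OF e(2)] e(1) \<tau>(2) size_edges_shape by metis
    hence I: "?I \<noteq> {}" by auto
    have sum: "distributed ?P lborel (\<lambda>x. \<Sum>i\<in>?I. x i) (erlang_density n lam)"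
      using iid_exponential_sum[OF lam finite_set_rtree I] by (simp add: card)
    have A: "?A \<in> sets metric_tree_space"
      using metric_tree_space_length_shape[OF B, of UNIV] by simp
    have "{\<omega> \<in> space M. T \<omega> \<in> ?A \<and> shape (T \<omega>) = \<tau>}
        = {\<omega> \<in> space M. tree_length (T \<omega>) \<in> B \<and> shape (T \<omega>) = \<tau>}"
      using measurable_space[OF T] by auto
    hence "\<P>(\<omega> in M. tree_length (T \<omega>) \<in> B \<and> shape (T \<omega>) = \<tau>)
        = \<P>(\<omega> in M. T \<omega> \<in> ?A \<bar> shape (T \<omega>) = \<tau>) * \<P>(\<omega> in M. shape (T \<omega>) = \<tau>)"
      using True by (simp add: cond_prob_def)
    also have "\<P>(\<omega> in M. T \<omega> \<in> ?A \<bar> shape (T \<omega>) = \<tau>)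
        = \<P>(x in ?P. map_rtree x e \<in> ?A)"
      using cond[OF planted A e(2)] True by (simp add: e(1))
    \<comment> \<open>Edge lengths are almost surely positive, so the restriction to
      \<open>metric_trees\<close> does not affect the probability.\<close>
    also have "\<dots> = \<P>(x in ?P. (\<Sum>i\<in>?I. x i) \<in> B)"
    proof -
      have [measurable]: "(\<lambda>x. x i) \<in> borel_measurable ?P" if "i \<in> ?I" for i
        unfolding iid_exponential_def
        using measurable_component_singleton[OF that, of "\<lambda>_. density lborel (exponential_density lam)"]
        by simp
      have eq: "map_rtree x e \<in> ?A \<longleftrightarrow> (\<forall>i\<in>?I. 0 < x i) \<and> (\<Sum>i\<in>?I. x i) \<in> B" for x
        using planted by (simp add: metric_trees_map_rtree tree_length_map_rtree[OF e(2)])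
      show ?thesis
        unfolding eq using iid_exponential_pos[OF lam finite_set_rtree I]
        by (intro measure_eq_AE) (auto elim!: eventually_mono)
    qed
    also have "\<dots> = measure (distr ?P lborel (\<lambda>x. \<Sum>i\<in>?I. x i)) B"
      using sum by (subst measure_distr)
        (auto simp: distributed_def vimage_def Int_def conj_commute)
    also have "\<dots> = measure (density lborel (erlang_density n lam)) B"
      using sum by (simp add: distributed_def)
    finally show ?thesis by simp
  qed
qed

text \<open>Summability and nonnegativity are claimed explicitly, since the infinite sum and
  \<open>ennreal\<close> would otherwise take values unrelated to the series.\<close>

theorem theorem6:
  fixes q lam :: real and M :: "'w measure" and T :: "'w \<Rightarrow> real rtree"
  assumes "1 / 2 \<le> q" and "q < 1" and "0 < lam"
    and "prob_space M"
    and "exponential_IGW q lam M T"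
  shows "(\<forall>x\<ge>0. summable (\<lambda>n. pdf_term q lam x (Suc n)) \<and>
                 0 \<le> (\<Sum>n. pdf_term q lam x (Suc n))) \<and>
         distributed M lborel (\<lambda>\<omega>. tree_length (T \<omega>))
           (\<lambda>x. if 0 \<le> x then ennreal (\<Sum>n. pdf_term q lam x (Suc n)) else 0) \<and>
         (\<forall>x\<ge>0. (\<lambda>n. cdf_term q lam x (Suc n)) sums
                   \<P>(\<omega> in M. tree_length (T \<omega>) \<le> x))"
proof -
  interpret prob_space M by fact
  have q: "0 < q" and lam: "0 < lam" using assms(1,3) by auto
  obtain p where T: "T \<in> measurable M metric_tree_space"
    and p: "has_pgf p (\<lambda>z. z + q * (1 - z) powr (1 / q))"
    and law: "distr M (count_space planted_trees) (\<lambda>\<omega>. shape (T \<omega>)) = GW p"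
    and cond: "\<And>e A. e \<in> planted_trees \<Longrightarrow> A \<in> sets metric_tree_space \<Longrightarrow> distinct_edges e \<Longrightarrow>
        \<P>(\<omega> in M. shape (T \<omega>) = shape e) > 0 \<Longrightarrow>
        \<P>(\<omega> in M. T \<omega> \<in> A \<bar> shape (T \<omega>) = shape e)
          = \<P>(x in iid_exponential lam (set_rtree e). map_rtree x e \<in> A)"
    using assms(5) unfolding exponential_IGW_def IGW_def by blast
  define len where "len \<omega> = tree_length (T \<omega>)" for \<omega>
  define sh where "sh \<omega> = shape (T \<omega>)" for \<omega>
  define P where "P = fps_nth (progeny_fps (pmf p))"
  define S where "S n = {\<tau> \<in> planted_trees. size (edges (\<tau> :: unit rtree)) = n}" for n
  define \<mu> where "\<mu> n = density lborel (\<lambda>y. ennreal (erlang_density n lam y))" for n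
  define pdf where "pdf y = (\<Sum>n. pdf_term q lam y (Suc n))" for y
  have sh_meas [measurable]: "sh \<in> measurable M (count_space planted_trees)"
    unfolding sh_def using measurable_compose[OF T measurable_shape] .
  have len_meas [measurable]: "len \<in> borel_measurable M"
    unfolding len_def using measurable_compose[OF T measurable_tree_length] .
  have sh_S: "{\<omega> \<in> space M. sh \<omega> \<in> S n} \<in> sets M" for n
    using measurable_sets[OF sh_meas, of "S n"]
    by (auto simp: S_def vimage_def Int_def conj_commute)
  have finS: "finite (S n)" for n
    unfolding S_def by (rule finite_subset[OF _ finite_trees_edges_eq[of n]]) auto

  \<comment> \<open>The linear coefficient is \<open>1 - q * (1 / q)\<close>.\<close>
  have "pmf p 1 = 0"
    using q by (simp add: IGW_offspring_pmf[OF p] fps_compose_uminus')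
  have P_nonneg: "0 \<le> P n" for n
    unfolding P_def progeny_fps_def by (auto intro!: sum_nonneg weight_nonneg)
  have P: "prob {\<omega> \<in> space M. sh \<omega> \<in> S n} = P n" for n
  proof -
    have "emeasure M {\<omega> \<in> space M. sh \<omega> \<in> S n}
        = emeasure (distr M (count_space planted_trees) sh) (S n)"
      by (subst emeasure_distr) (auto simp: S_def intro!: arg_cong[of _ _ "emeasure M"])
    also have "\<dots> = ennreal (P n)"
      using emeasure_GW_size_edges[OF \<open>pmf p 1 = 0\<close>, of n] law
      by (simp add: S_def P_def sh_def[abs_def])
    finally show ?thesis by (simp add: emeasure_eq_measure P_nonneg)
  qed
  have P_le: "\<bar>P n\<bar> \<le> 1" for n
    using P_nonneg[of n] prob_le_1 unfolding P[symmetric] by simp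
  \<comment> \<open>A planar tree has at least one node, so the series has no constant term: almost
    surely the tree has a stem.\<close>
  have P0: "P 0 = 0"
    unfolding P_def by (subst progeny_fps_eq) simp

  \<comment> \<open>The density as a mixture of Erlang densities\<close>
  have pdf_sums: "(\<lambda>n. pdf_term q lam y (Suc n))
      sums (lam * (exp (- (lam * y)) * (\<Sum>k. P (Suc k) * (lam * y) ^ k / fact k)))" for y
    using sums_mult[OF binomial_transform_exp_series[of "\<lambda>k. P (Suc k)" "lam * y"], of lam]
      P_le q unfolding P_def IGW_progeny_transform[OF p less_imp_neq[OF q, symmetric]]
    by (simp add: pdf_term_gbinomial[OF q] del: of_nat_Suc power_Suc)
  have mixture: "(\<lambda>n. P (Suc n) * erlang_density n lam y) sums pdf y" if "0 \<le> y" for y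
  proof -
    have "(\<lambda>k. lam * exp (- (lam * y)) * (P (Suc k) * (lam * y) ^ k / fact k))
        sums (lam * exp (- (lam * y)) * (\<Sum>k. P (Suc k) * (lam * y) ^ k / fact k))"
      using summable_exp_series[of "\<lambda>k. P (Suc k)" "lam * y"] P_le
      by (intro sums_mult summable_sums) auto
    moreover have "lam * exp (- (lam * y)) * (P (Suc k) * (lam * y) ^ k / fact k)
        = P (Suc k) * erlang_density k lam y" for k
      using that by (simp add: erlang_density_def power_mult_distrib mult_ac)
    ultimately show ?thesis
      using pdf_sums[of y] by (simp add: pdf_def sums_iff mult_ac)
  qed
  \<comment> \<open>The sign cannot be read off the alternating series but is visible in the
    mixture.\<close>
  have pdf_nonneg: "0 \<le> pdf y" if "0 \<le> y" for y
    by (rule sums_le[OF _ sums_zero mixture[OF that]]) (use P_nonneg lam in simp)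
  have pdf_meas [measurable]: "pdf \<in> borel_measurable borel"
    unfolding pdf_def[abs_def] pdf_term_def by measurable

  \<comment> \<open>The law of the length, by number of edges\<close>
  have strata: "emeasure M {\<omega> \<in> space M. len \<omega> \<in> B \<and> sh \<omega> \<in> S (Suc n)}
      = ennreal (P (Suc n)) * emeasure (\<mu> n) B"
    if B [measurable]: "B \<in> sets borel" for B n
  proof -
    interpret \<mu>: prob_space "\<mu> n"
      unfolding \<mu>_def by (rule prob_space_erlang_density[OF lam])
    have meas: "{\<omega> \<in> space M. len \<omega> \<in> B \<and> sh \<omega> = \<tau>} \<in> sets M" if "\<tau> \<in> S (Suc n)" for \<tau>
      using that unfolding S_def by measurable
    have meas': "{\<omega> \<in> space M. sh \<omega> = \<tau>} \<in> sets M" if "\<tau> \<in> S (Suc n)" for \<tau>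
      using that unfolding S_def by measurable
    have "{\<omega> \<in> space M. len \<omega> \<in> B \<and> sh \<omega> \<in> S (Suc n)}
        = (\<Union>\<tau>\<in>S (Suc n). {\<omega> \<in> space M. len \<omega> \<in> B \<and> sh \<omega> = \<tau>})" by auto
    hence "prob {\<omega> \<in> space M. len \<omega> \<in> B \<and> sh \<omega> \<in> S (Suc n)}
        = (\<Sum>\<tau>\<in>S (Suc n). prob {\<omega> \<in> space M. len \<omega> \<in> B \<and> sh \<omega> = \<tau>})"
      by (simp only:, intro finite_measure_finite_Union)
         (use finS meas in \<open>auto simp: disjoint_family_on_def\<close>)
    \<comment> \<open>All shapes with \<open>n + 1\<close> edges share the same Erlang law, which
      factors out of the sum.\<close>
    also have "\<dots> = (\<Sum>\<tau>\<in>S (Suc n). prob {\<omega> \<in> space M. sh \<omega> = \<tau>} * measure (\<mu> n) B)"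
      unfolding len_def sh_def \<mu>_def
      by (intro sum.cong refl prob_length_given_shape[OF assms(4) T lam cond _ _ B])
         (auto simp: S_def)
    also have "\<dots> = prob (\<Union>\<tau>\<in>S (Suc n). {\<omega> \<in> space M. sh \<omega> = \<tau>}) * measure (\<mu> n) B"
      unfolding sum_distrib_right[symmetric]
      by (subst finite_measure_finite_Union)
         (use finS meas' in \<open>auto simp: disjoint_family_on_def\<close>)
    also have "(\<Union>\<tau>\<in>S (Suc n). {\<omega> \<in> space M. sh \<omega> = \<tau>}) = {\<omega> \<in> space M. sh \<omega> \<in> S (Suc n)}"
      by auto
    finally show ?thesis
      by (simp add: P emeasure_eq_measure \<mu>.emeasure_eq_measure ennreal_mult P_nonneg)
  qed

  have law_len: "emeasure M {\<omega> \<in> space M. len \<omega> \<in> B}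
      = (\<integral>\<^sup>+y\<in>B. (if 0 \<le> y then ennreal (pdf y) else 0) \<partial>lborel)"
    if B [measurable]: "B \<in> sets borel" for B
  proof -
    let ?E = "\<lambda>n. {\<omega> \<in> space M. len \<omega> \<in> B \<and> sh \<omega> \<in> S n}"
    have E: "?E n \<in> sets M" for n
    proof -
      have "?E n = {\<omega> \<in> space M. len \<omega> \<in> B} \<inter> {\<omega> \<in> space M. sh \<omega> \<in> S n}" by auto
      also have "\<dots> \<in> sets M" by (intro sets.Int sh_S) measurable
      finally show ?thesis .
    qed
    have "{\<omega> \<in> space M. len \<omega> \<in> B} = (\<Union>n. ?E n)"
      using measurable_space[OF sh_meas] by (auto simp: S_def)
    hence "emeasure M {\<omega> \<in> space M. len \<omega> \<in> B} = (\<Sum>n. emeasure M (?E n))"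
      using E by (subst suminf_emeasure) (auto simp: disjoint_family_on_def S_def)
    also have "\<dots> = (\<Sum>n. emeasure M (?E (Suc n)))"
    proof -
      have "emeasure M (?E 0) \<le> emeasure M {\<omega> \<in> space M. sh \<omega> \<in> S 0}"
        by (intro emeasure_mono sh_S) auto
      hence "emeasure M (?E 0) = 0" using P[of 0] by (simp add: emeasure_eq_measure P0)
      thus ?thesis
        using suminf_offset[of "\<lambda>n. emeasure M (?E n)" 1] by simp
    qed
    also have "\<dots> = (\<Sum>n. \<integral>\<^sup>+y. ennreal (P (Suc n)) *
        (ennreal (erlang_density n lam y) * indicator B y) \<partial>lborel)"
      unfolding strata[OF B] \<mu>_def
      by (intro suminf_cong) (simp add: emeasure_density nn_integral_cmult)
    also have "\<dots> = (\<integral>\<^sup>+y. (\<Sum>n. ennreal (P (Suc n)) *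
        (ennreal (erlang_density n lam y) * indicator B y)) \<partial>lborel)"
      by (rule nn_integral_suminf[symmetric]) measurable
    also have "\<dots> = (\<integral>\<^sup>+y\<in>B. (if 0 \<le> y then ennreal (pdf y) else 0) \<partial>lborel)"
    proof (rule nn_integral_cong)
      fix y
      have "(\<Sum>n. ennreal (P (Suc n)) * ennreal (erlang_density n lam y))
          = (if 0 \<le> y then ennreal (pdf y) else 0)"
      proof (cases "0 \<le> y")
        case True
        have "(\<Sum>n. ennreal (P (Suc n) * erlang_density n lam y)) = ennreal (pdf y)"
          using mixture[OF True] P_nonneg lam by (intro suminf_ennreal_eq) auto
        thus ?thesis using True P_nonneg lam by (simp add: ennreal_mult)
      qed (simp add: erlang_density_def)
      thus "(\<Sum>n. ennreal (P (Suc n)) * (ennreal (erlang_density n lam y) * indicator B y))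
          = (if 0 \<le> y then ennreal (pdf y) else 0) * indicator B y"
        by (simp add: indicator_def)
    qed
    finally show ?thesis .
  qed

  have "distr M lborel len = density lborel (\<lambda>y. if 0 \<le> y then ennreal (pdf y) else 0)"
  proof (rule measure_eqI)
    fix B assume "B \<in> sets (distr M lborel len)"
    hence B: "B \<in> sets borel" by simp
    thus "emeasure (distr M lborel len) B
        = emeasure (density lborel (\<lambda>y. if 0 \<le> y then ennreal (pdf y) else 0)) B"
      using law_len[OF B]
      by (simp add: emeasure_distr emeasure_density vimage_def Int_def conj_commute)
  qed simp
  hence distributed: "distributed M lborel len (\<lambda>y. if 0 \<le> y then ennreal (pdf y) else 0)"
    unfolding distributed_def by simp

  \<comment> \<open>The distribution function by termwise integration\<close>
  define a where "a n = pdf_term q lam 1 (Suc n)" for n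
  have a: "pdf_term q lam y (Suc n) = a n * y ^ n" for y n
    by (simp add: a_def pdf_term_def)
  have cdf_term: "cdf_term q lam y (Suc n) = a n / real (Suc n) * y ^ Suc n" for y n
    by (simp add: cdf_term_eq_pdf_term a)
  have summ: "summable (\<lambda>n. a n * y ^ n)" for y
    using pdf_sums[of y] by (simp add: a sums_iff)
  have cdf: "(\<lambda>n. cdf_term q lam x (Suc n)) sums prob {\<omega> \<in> space M. len \<omega> \<le> x}" if x: "0 \<le> x" for x
  proof -
    let ?L = "\<lambda>y. \<Sum>n. a n / real (Suc n) * y ^ Suc n"
    have deriv: "(?L has_real_derivative pdf y) (at y)" for y
      using DERIV_powser_antiderivative[OF summ, of y] by (simp only: pdf_def a)
    have "ennreal (prob {\<omega> \<in> space M. len \<omega> \<le> x})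
        = (\<integral>\<^sup>+y\<in>{..x}. (if 0 \<le> y then ennreal (pdf y) else 0) \<partial>lborel)"
      using law_len[of "{..x}"] by (simp add: emeasure_eq_measure)
    also have "\<dots> = (\<integral>\<^sup>+y. ennreal (pdf y) * indicator {0..x} y \<partial>lborel)"
      by (intro nn_integral_cong) (auto simp: indicator_def)
    also have "\<dots> = ennreal (?L x - ?L 0)"
    proof (rule nn_integral_FTC_Icc)
      show "(?L has_real_derivative pdf y) (at y)" for y by (rule deriv)
    qed (use x pdf_nonneg in auto)
    \<comment> \<open>Every term of \<open>?L\<close> contains a positive power of the argument, so
      \<open>?L 0\<close> is 0.\<close>
    finally have "ennreal (prob {\<omega> \<in> space M. len \<omega> \<le> x}) = ennreal (?L x)"
      by simp
    \<comment> \<open>This gives \<open>0 \<le> ?L x\<close>; \<open>ennreal\<close> is injective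
      only on nonnegative reals.\<close>
    moreover have "?L 0 \<le> ?L x"
      using deriv pdf_nonneg by (intro DERIV_nonneg_imp_nondecreasing[OF x]) blast
    ultimately have "prob {\<omega> \<in> space M. len \<omega> \<le> x} = ?L x"
      by (simp add: ennreal_inj)
    thus ?thesis
      using summable_powser_antiderivative[OF summ, of x]
      by (simp add: cdf_term sums_iff)
  qed
  show ?thesis
    using pdf_sums pdf_nonneg distributed cdf
    unfolding pdf_def[abs_def] len_def[abs_def] by (auto simp: sums_iff)
qed

end
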